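(* Let $\mathcal{X}\subset\mathbb{R}^d$ be closed and convex, and let $f,g$ be continuous on $\mathcal{X}$ with $\partial f(x)\neq\emptyset$, $\partial g(x)\neq\emptyset$ for all $x\in\mathcal{X}$. Suppose there is $M>0$ with $\|\zeta_f\|\le M$, $\|\zeta_g\|\le M$ for all $x\in\mathcal{X}$, $\zeta_f\in\partial f(x)$, $\zeta_g\in\partial g(x)$. Suppose that $f$ is $\rho$-weakly convex on $\mathcal{X}$ and $g$ is convex on $\mathcal{X}$; that there is $x_{\mathrm{feas}}\in\mathrm{relint}(\mathcal{X})$ with $g(x_{\mathrm{feas}})<0$; and that there is $D>0$ with $\|x-x'\|\le D$ for all $x,x'\in\mathcal{X}$. Suppose stochastic oracles are available: for any $x\in\mathcal{X}$, stochastic subgradients $\xi_f,\xi_g$ and a stochastic value $\omega$ can be generated independently with $\mathbb{E}[\omega]=g(x)$, $\mathbb{E}[\xi_f]\in\partial f(x)$, $\mathbb{E}[\xi_g]\in\partial g(x)$, $\mathbb{E}[\exp(\|\xi_f\|^2/M^2)]\le e$ and $\mathbb{E}[\exp(\|\xi_g\|^2/M^2)]\le e$. Suppose moreover that function values of $g$ are exact: $\bar\omega^{(t)}=g(x^{(t)})$ for all $t$ deterministically (with $B=1$). Let $\hat\rho>\rho$, $\Lambda:=(MD+\hat\rho D^2)/(-g(x_{\mathrm{feas}}))$, $\epsilon>0$, $\delta\in(0,1)$, and $$\widehat{x}^{(t)}:=\arg\min_{y\in\mathcal{X}}\Big\{f(y)+\tfrac{\hat\rho}{2}\|y-x^{(t)}\|^2:\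 g(y)\le0\Big\}.$$ Let $x^{(\tau)}$ be generated by the stochastic switching subgradient method (described in the context). Then, with probability at least $1-\delta$, $$\mathbb{E}_\tau\big[\|\widehat{x}^{(\tau)}-x^{(\tau)}\|\big]\le\epsilon\quad\text{and}\quad\mathbb{E}_\tau\big[g(x^{(\tau)})\big]\le\frac{\epsilon^2(\hat\rho-\rho)}{1+\Lambda}$$ in either of the following cases. Case I: $S=0$, $\epsilon_t=\frac{\epsilon^2(\hat\rho-\rho)}{1+\Lambda}$, $\eta_t=\frac{2\epsilon^2(\hat\rho-\rho)}{5(1+\Lambda)M^2}$, and $$T\ge\max\left\{\frac{25M^2D^2(1+\Lambda)^2}{4\epsilon^4(\hat\rho-\rho)^2},\ \max\Big\{12\ln(8/\delta),\tfrac{16}{9}\ln^2(8/\delta)\Big\},\ \frac{300\ln(4/\delta)M^2D^2(1+\Lambda)^2}{\epsilon^4(\hat\rho-\rho)^2}\right\}$$ (a bound of order $O(1/\epsilon^4)$). Case II: $S=T/2$, $\eta_t=\frac{D}{M\sqrt{t+1}}$, $\epsilon_t=\frac{EMD}{\sqrt{t+1}}$, where $E$ is any positive constant with $$E\ge4+\frac{2\pi}{\sqrt6}\max\left\{\sqrt{12\ln(8/\delta)},\tfrac43\ln(8/\delta)\right\}+8\sqrt{3\ln(4/\delta)},$$ and $T\ge\frac{2E^2M^2D^2(1+\Lambda)^2}{\epsilon^4(\hat\rho-\rho)^2}$ (a bound of order $O(1/\epsilon^4)$).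
   Context: $\|\cdot\|$ is the Euclidean norm. For $h:\mathbb{R}^d\to\mathbb{R}\cup\{+\infty\}$, $\partial h(x)=\{\zeta\in\mathbb{R}^d: h(x')\ge h(x)+\langle\zeta,x'-x\rangle+o(\|x'-x\|),\ x'\to x\}$. $h$ is $\rho$-weakly convex on $\mathcal{X}$ ($\rho\ge0$) if $h(x)\ge h(x')+\langle\zeta,x-x'\rangle-\frac{\rho}{2}\|x-x'\|^2$ for all $x,x'\in\mathcal{X}$ and $\zeta\in\partial h(x')$; convex on $\mathcal{X}$ is the case $\rho=0$. The problem under study is $\min_{x\in\mathcal{X}}f(x)$ subject to $g(x)\le0$. $\mathrm{proj}_{\mathcal X}$ is Euclidean projection onto $\mathcal{X}$; relint is relative interior. Stochastic switching subgradient method. Input: $x^{(0)}\in\mathcal{X}$, number of iterations $T$ (a positive integer), tolerances $\epsilon_t\ge0$, stepsizes $\eta_t$, mini-batch size $B$, and an integer starting index $S$. Initialize $I=J=\emptyset$. For $t=0,1,\dots,T-1$: generate a mini-batch $\omega_1^{(t)},\dots,\omega_B^{(t)}$ of stochastic estimators of $g(x^{(t)})$ and set $\bar\omega^{(t)}=\frac1B\sum_{i=1}^B\omega_i^{(t)}$. If $\bar\omega^{(t)}\le\epsilon_t$, generate a stochastic subgradient $\xi_f^{(t)}$ of $f$ at $x^{(t)}$, set $x^{(t+1)}=\mathrm{proj}_{\mathcal X}(x^{(t)}-\eta_t\xi_f^{(t)})$ and, if $t\ge S$, add $t$ to $I$; otherwise generate a stochastic subgradient $\xi_g^{(t)}$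 of $g$ at $x^{(t)}$, set $x^{(t+1)}=\mathrm{proj}_{\mathcal X}(x^{(t)}-\eta_t\xi_g^{(t)})$ and, if $t\ge S$, add $t$ to $J$. Conditionally on everything generated before iteration $t$, the oracle outputs at iteration $t$ are independent and follow the oracle distributions at $x^{(t)}$. Output: $x^{(\tau)}$ with $\tau$ sampled from $I$ with $\mathrm{Prob}(\tau=t)=\eta_t/\sum_{s\in I}\eta_s$. $\mathbb{E}_\tau$ is the expectation over the random index $\tau$ only (conditionally on the iterates); "with probability at least $1-\delta$" refers to the randomness of the oracles. A guarantee about $x^{(\tau)}$ is understood to include that $I$ is nonempty. *)

theory Defs
  imports "HOL-Probability.Probability" "HOL-Library.Landau_Symbols"
begin

section \<open>Weakly convex functions\<close>

definition frechet_subdiff :: "('a::euclidean_space \<Rightarrow> ereal) \<Rightarrow> 'a \<Rightarrow> 'a set" where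
  "frechet_subdiff h x =
     {\<zeta>. \<exists>r. r \<in> o[at x](\<lambda>x'. norm (x' - x)) \<and>
            (\<forall>\<^sub>F x' in at x. h x' \<ge> h x + ereal (\<zeta> \<bullet> (x' - x)) + ereal (r x'))}"

definition weakly_convex_on :: "real \<Rightarrow> 'a::euclidean_space set \<Rightarrow> ('a \<Rightarrow> ereal) \<Rightarrow> bool" where
  "weakly_convex_on \<rho> X h \<longleftrightarrow> 0 \<le> \<rho> \<and>
     (\<forall>x\<in>X. \<forall>x'\<in>X. \<forall>\<zeta>\<in>frechet_subdiff h x'.
        h x \<ge> h x' + ereal (\<zeta> \<bullet> (x - x')) - ereal (\<rho> / 2 * (norm (x - x'))\<^sup>2))"

text \<open>
  The real-valued, continuous functions on \<open>X\<close> that may take the value \<open>\<infinity>\<close> outside \<open>X\<close>.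
\<close>

definition proper_continuous_on :: "'a::euclidean_space set \<Rightarrow> ('a \<Rightarrow> ereal) \<Rightarrow> bool" where
  "proper_continuous_on X h \<longleftrightarrow>
     (\<forall>x. h x \<noteq> -\<infinity>) \<and> (\<forall>x\<in>X. h x \<noteq> \<infinity>) \<and> continuous_on X h"

definition constrained_prox ::
  "'a::euclidean_space set \<Rightarrow> ('a \<Rightarrow> ereal) \<Rightarrow> ('a \<Rightarrow> ereal) \<Rightarrow> real \<Rightarrow> 'a \<Rightarrow> 'a" where
  "constrained_prox X f g \<rho> x =
     arg_min (\<lambda>y. f y + ereal (\<rho> / 2 * (norm (y - x))\<^sup>2)) (\<lambda>y. y \<in> X \<and> g y \<le> 0)"

section \<open>Stochastic oracles\<close>

text \<open>
  An oracle is given by the distribution of its output at each query point.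
\<close>

definition value_oracle ::
  "'a::euclidean_space set \<Rightarrow> ('a \<Rightarrow> ereal) \<Rightarrow> ('a \<Rightarrow> real measure) \<Rightarrow> bool" where
  "value_oracle X h Q \<longleftrightarrow> (\<forall>x\<in>X. prob_space (Q x) \<and> sets (Q x) = sets borel \<and>
     integrable (Q x) (\<lambda>v. v) \<and> (\<integral>v. v \<partial>Q x) = real_of_ereal (h x))"

definition subgradient_oracle ::
  "'a::euclidean_space set \<Rightarrow> ('a \<Rightarrow> ereal) \<Rightarrow> real \<Rightarrow> ('a \<Rightarrow> 'a measure) \<Rightarrow> bool" where
  "subgradient_oracle X h M Q \<longleftrightarrow> (\<forall>x\<in>X. prob_space (Q x) \<and> sets (Q x) = sets borel \<and>
     integrable (Q x) (\<lambda>v. v) \<and> (\<integral>v. v \<partial>Q x) \<in> frechet_subdiff h x \<and>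
     (\<integral>\<^sup>+v. ennreal (exp ((norm v)\<^sup>2 / M\<^sup>2)) \<partial>Q x) \<le> ennreal (exp 1))"

section \<open>The stochastic switching subgradient method\<close>

text \<open>
  \<open>\<omega> t i\<close>, \<open>i < B\<close>, is the mini-batch of estimators drawn in iteration \<open>t\<close>, and \<open>\<xi> t\<close> is the one
  stochastic subgradient drawn in iteration \<open>t\<close>: it is a subgradient sample of \<open>f\<close> if the mean
  of the batch is at most the tolerance, and of \<open>g\<close> otherwise.
\<close>

primrec iterate :: "'a::euclidean_space set \<Rightarrow> (nat \<Rightarrow> real) \<Rightarrow> 'a \<Rightarrow> (nat \<Rightarrow> 's \<Rightarrow> 'a) \<Rightarrow>
    nat \<Rightarrow> 's \<Rightarrow> 'a" where
  "iterate X \<eta> x0 \<xi> 0 w = x0"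
| "iterate X \<eta> x0 \<xi> (Suc t) w =
     closest_point X (iterate X \<eta> x0 \<xi> t w - \<eta> t *\<^sub>R \<xi> t w)"

definition batch_mean :: "nat \<Rightarrow> (nat \<Rightarrow> nat \<Rightarrow> 's \<Rightarrow> real) \<Rightarrow> nat \<Rightarrow> 's \<Rightarrow> real" where
  "batch_mean B \<omega> t w = (\<Sum>i<B. \<omega> t i w) / real B"

text \<open>
  The sigma-algebra generated by the first \<open>m\<close> mini-batches and the first \<open>n\<close> subgradients.
\<close>

definition history :: "'s measure \<Rightarrow> nat \<Rightarrow> (nat \<Rightarrow> nat \<Rightarrow> 's \<Rightarrow> real) \<Rightarrow>
    (nat \<Rightarrow> 's \<Rightarrow> 'a::euclidean_space) \<Rightarrow> nat \<Rightarrow> nat \<Rightarrow> 's measure" where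
  "history P B \<omega> \<xi> m n = sigma (space P)
     ({\<omega> t i -` A \<inter> space P | t i A. t < m \<and> i < B \<and> A \<in> sets borel} \<union>
      {\<xi> t -` A \<inter> space P | t A. t < n \<and> A \<in> sets borel})"

text \<open>
  The last two conjuncts describe the law of the oracle outputs. Given everything generated before
  iteration \<open>t\<close>, the batch consists of \<open>B\<close> independent samples of the value oracle at the current
  iterate. Given in addition this batch, the subgradient follows the oracle
  distribution of \<open>f\<close> or \<open>g\<close> (whichever is queried) at the current iterate; that this conditional
  distribution depends on the batch only through the selected branch expresses the independence of
  the oracle outputs within one iteration.
\<close>

definition switching_run :: "'s measure \<Rightarrow> 'a::euclidean_space set \<Rightarrow>
    ('a \<Rightarrow> real measure) \<Rightarrow> ('a \<Rightarrow> 'a measure) \<Rightarrow> ('a \<Rightarrow> 'a measure) \<Rightarrow>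
    nat \<Rightarrow> nat \<Rightarrow> (nat \<Rightarrow> real) \<Rightarrow> (nat \<Rightarrow> real) \<Rightarrow> 'a \<Rightarrow>
    (nat \<Rightarrow> nat \<Rightarrow> 's \<Rightarrow> real) \<Rightarrow> (nat \<Rightarrow> 's \<Rightarrow> 'a) \<Rightarrow> bool" where
  "switching_run P X Q\<^sub>\<omega> Q\<^sub>f Q\<^sub>g B T tol \<eta> x0 \<omega> \<xi> \<longleftrightarrow>
     prob_space P \<and> x0 \<in> X \<and> 0 < B \<and> 0 < T \<and>
     (\<forall>t<T. (\<forall>i<B. \<omega> t i \<in> borel_measurable P) \<and> \<xi> t \<in> borel_measurable P) \<and>
     (\<forall>t<T. \<forall>A. (\<forall>i<B. A i \<in> sets borel) \<longrightarrow>
        (AE w in P. real_cond_exp P (history P B \<omega> \<xi> t t)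
             (indicator {w \<in> space P. \<forall>i<B. \<omega> t i w \<in> A i}) w
           = (\<Prod>i<B. measure (Q\<^sub>\<omega> (iterate X \<eta> x0 \<xi> t w)) (A i)))) \<and>
     (\<forall>t<T. \<forall>A\<in>sets borel.
        (AE w in P. real_cond_exp P (history P B \<omega> \<xi> (Suc t) t)
             (indicator {w \<in> space P. \<xi> t w \<in> A}) w
           = (if batch_mean B \<omega> t w \<le> tol t
              then measure (Q\<^sub>f (iterate X \<eta> x0 \<xi> t w)) A
              else measure (Q\<^sub>g (iterate X \<eta> x0 \<xi> t w)) A)))"

text \<open>
  The index set \<open>I\<close> of the method. Its counterpart \<open>J\<close> plays no role for the output.
\<close>

definition objective_steps :: "nat \<Rightarrow> nat \<Rightarrow> nat \<Rightarrow> (nat \<Rightarrow> real) \<Rightarrow>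
    (nat \<Rightarrow> nat \<Rightarrow> 's \<Rightarrow> real) \<Rightarrow> 's \<Rightarrow> nat set" where
  "objective_steps S T B tol \<omega> w = {t. S \<le> t \<and> t < T \<and> batch_mean B \<omega> t w \<le> tol t}"

text \<open>
  The law of the output index \<open>\<tau>\<close>. It is meaningful only for finite nonempty \<open>I\<close> and positive
  step sizes, since \<open>embed_pmf\<close> is unspecified on functions that are not probability mass functions.
\<close>

definition output_index :: "(nat \<Rightarrow> real) \<Rightarrow> nat set \<Rightarrow> nat pmf" where
  "output_index \<eta> I = embed_pmf (\<lambda>t. if t \<in> I then \<eta> t / (\<Sum>s\<in>I. \<eta> s) else 0)"

end

(*
  Let p(x) be the constrained proximal point of x and e(x) the value of the proximal problem. One
  step x' = proj(x - \<eta> v) changes e by at most \<rho>h (\<eta> <v, p(x) - x> + \<eta>^2 |v|^2 / 2), while e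
  oscillates by at most \<rho>h D^2 / 2 over X. In expectation <v, p(x) - x> is at most
  \<Lambda> tol - (\<rho>h - \<rho>) |p(x) - x|^2 on an objective step (strong convexity, and the Slater point in
  place of a multiplier) and at most -tol on a constraint step (convexity of g). Summation bounds the
  weighted mean of |p(x) - x|^2 over the objective steps, up to two noise terms. Both have conditional
  exponential moments under control, so each exceeds its budget with probability at most \<delta> / 2.
*)
theory Submission
  imports Defs
begin

section \<open>The constrained proximal point\<close>

text \<open>Two obstacles shape the probabilistic half. Sampled subgradients are light-tailed but
  unbounded, so inequalities for bounded increments do not apply; both noise sums, the squared sizes
  and the excess of \<open><v, p(x) - x>\<close> over its mean bound, are treated by Chernoff's
  method, multiplying conditional exponential moments along the run. Moreover an oracle is a bare
  family of distributions, without measurability in the query point, and the conditional law of a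
  sample is given event by event; it has to be made integrable against functions of the past and the
  sample jointly. Exact values of \<open>g\<close> make the branch a function of the iterate and the
  tolerance, so the mean bound is one too. The step sizes enter only through a deterministic
  inequality, the budget: the oscillation of \<open>e\<close> (divided by \<open>\<rho>h\<close>)
  and both noise allowances together may not exceed the sum of \<open>\<eta> t * tol t\<close>. On
  constraint steps the decrease cancels its term of this sum exactly, which is why the remainder
  speaks of objective steps alone.\<close>

lemma norm_convex_combination_power2:
  fixes a b c :: "'a::real_inner"
  shows "(norm ((1 - u) *\<^sub>R a + u *\<^sub>R b - c))\<^sup>2 =
    (1 - u) * (norm (a - c))\<^sup>2 + u * (norm (b - c))\<^sup>2 - u * (1 - u) * (norm (a - b))\<^sup>2"
  by (simp add: power2_norm_eq_inner inner_diff_left inner_diff_right inner_add_left inner_add_right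
      inner_commute algebra_simps)

lemma proper_continuous_on_real:
  assumes "proper_continuous_on X h"
  shows "y \<in> X \<Longrightarrow> ereal (real_of_ereal (h y)) = h y"
    and "continuous_on X (\<lambda>y. real_of_ereal (h y))"
proof -
  have fin: "\<bar>h y\<bar> \<noteq> \<infinity>" if "y \<in> X" for y
    using assms that unfolding proper_continuous_on_def by auto
  show "y \<in> X \<Longrightarrow> ereal (real_of_ereal (h y)) = h y"
    using fin by (simp add: ereal_real)
  show "continuous_on X (\<lambda>y. real_of_ereal (h y))"
    using assms continuous_on_iff_real[of X h] fin unfolding proper_continuous_on_def o_def by auto
qed

lemma weakly_convex_on_real:
  assumes "proper_continuous_on X h" "weakly_convex_on r X h" "y \<in> X" "x \<in> X"
    "\<zeta> \<in> frechet_subdiff h y"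
  shows "real_of_ereal (h x) \<ge> real_of_ereal (h y) + \<zeta> \<bullet> (x - y) - r / 2 * (norm (x - y))\<^sup>2"
proof -
  have "h x \<ge> h y + ereal (\<zeta> \<bullet> (x - y)) - ereal (r / 2 * (norm (x - y))\<^sup>2)"
    using assms unfolding weakly_convex_on_def by blast
  moreover have "h x = ereal (real_of_ereal (h x))" "h y = ereal (real_of_ereal (h y))"
    using proper_continuous_on_real(1)[OF assms(1)] assms by auto
  ultimately show ?thesis
    by (metis ereal_less_eq(3) ereal_minus(1) plus_ereal.simps(1))
qed

text \<open>The subgradient inequality at the interpolated point is used towards both ends. The
  displacements are opposite multiples of \<open>y - z\<close>, so with weights \<open>1 - u\<close>
  and \<open>u\<close> the linear terms cancel and the quadratic losses add up to
  \<open>u * (1 - u)\<close>.\<close>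

lemma weakly_convex_on_combination:
  assumes h: "proper_continuous_on X h" "weakly_convex_on r X h"
    and "convex X" "\<And>y. y \<in> X \<Longrightarrow> frechet_subdiff h y \<noteq> {}"
    and y: "y \<in> X" and z: "z \<in> X" and u: "0 \<le> u" "u \<le> 1"
  shows "real_of_ereal (h ((1 - u) *\<^sub>R y + u *\<^sub>R z)) \<le>
    (1 - u) * real_of_ereal (h y) + u * real_of_ereal (h z) + r / 2 * (u * (1 - u) * (norm (y - z))\<^sup>2)"
proof -
  define w where "w = (1 - u) *\<^sub>R y + u *\<^sub>R z"
  have w: "w \<in> X" unfolding w_def using assms by (intro convexD) auto
  then obtain \<zeta> where \<zeta>: "\<zeta> \<in> frechet_subdiff h w" using assms by blast
  have yw: "y - w = u *\<^sub>R (y - z)" and zw: "z - w = - ((1 - u) *\<^sub>R (y - z))"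
    unfolding w_def by (simp_all add: algebra_simps)
  have 1: "real_of_ereal (h w) + u * (\<zeta> \<bullet> (y - z)) - r / 2 * (u\<^sup>2 * (norm (y - z))\<^sup>2) \<le> real_of_ereal (h y)"
    using weakly_convex_on_real[OF h w y \<zeta>] unfolding yw by (simp add: power_mult_distrib)
  have 2: "real_of_ereal (h w) - (1 - u) * (\<zeta> \<bullet> (y - z)) - r / 2 * ((1 - u)\<^sup>2 * (norm (y - z))\<^sup>2) \<le> real_of_ereal (h z)"
    using weakly_convex_on_real[OF h w z \<zeta>] unfolding zw by (simp add: power_mult_distrib)
  have "(1 - u) * (real_of_ereal (h w) + u * (\<zeta> \<bullet> (y - z)) - r / 2 * (u\<^sup>2 * (norm (y - z))\<^sup>2))
     + u * (real_of_ereal (h w) - (1 - u) * (\<zeta> \<bullet> (y - z)) - r / 2 * ((1 - u)\<^sup>2 * (norm (y - z))\<^sup>2))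
     \<le> (1 - u) * real_of_ereal (h y) + u * real_of_ereal (h z)"
    using 1 2 u by (intro add_mono mult_left_mono) auto
  then show ?thesis unfolding w_def[symmetric]
    by (simp add: field_simps power2_eq_square)
qed

locale constrained_problem =
  fixes X :: "'a::euclidean_space set" and f g :: "'a \<Rightarrow> ereal" and M D \<rho> \<rho>h :: real and z :: 'a
  assumes closed_X: "closed X" and convex_X: "convex X"
    and f_cont: "proper_continuous_on X f" and g_cont: "proper_continuous_on X g"
    and f_subdiff: "\<And>y. y \<in> X \<Longrightarrow> frechet_subdiff f y \<noteq> {}"
    and g_subdiff: "\<And>y. y \<in> X \<Longrightarrow> frechet_subdiff g y \<noteq> {}"
    and M_pos: "M > 0"
    and f_bound: "\<And>y \<zeta>. y \<in> X \<Longrightarrow> \<zeta> \<in> frechet_subdiff f y \<Longrightarrow> norm \<zeta> \<le> M"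
    and g_bound: "\<And>y \<zeta>. y \<in> X \<Longrightarrow> \<zeta> \<in> frechet_subdiff g y \<Longrightarrow> norm \<zeta> \<le> M"
    and f_weakly_convex: "weakly_convex_on \<rho> X f"
    and g_convex: "weakly_convex_on 0 X g"
    and z_in: "z \<in> X" and g_z: "g z < 0"
    and D_pos: "D > 0" and diameter: "\<And>y y'. y \<in> X \<Longrightarrow> y' \<in> X \<Longrightarrow> norm (y - y') \<le> D"
    and \<rho>h_gt: "\<rho>h > \<rho>"
begin

definition F :: "'a \<Rightarrow> real" where "F y = real_of_ereal (f y)"
definition G :: "'a \<Rightarrow> real" where "G y = real_of_ereal (g y)"
definition prox :: "'a \<Rightarrow> 'a" where "prox x = constrained_prox X f g \<rho>h x"
definition model :: "'a \<Rightarrow> 'a \<Rightarrow> real" where "model x y = F y + \<rho>h / 2 * (norm (y - x))\<^sup>2"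
text \<open>This is \<open>\<Lambda>\<close>: the size that Slater's condition permits for a
  Lagrange multiplier of the proximal problem. No multiplier is constructed; the quotient arises in
  \<open>prox_penalty\<close>.\<close>

definition multiplier_bound :: real where "multiplier_bound = (M * D + \<rho>h * D\<^sup>2) / (- G z)"

lemma f_F: "y \<in> X \<Longrightarrow> f y = ereal (F y)" and g_G: "y \<in> X \<Longrightarrow> g y = ereal (G y)"
  unfolding F_def G_def using proper_continuous_on_real(1)[OF f_cont] proper_continuous_on_real(1)[OF g_cont]
  by auto

lemma continuous_F: "continuous_on X F" and continuous_G: "continuous_on X G"
  using proper_continuous_on_real(2)[OF f_cont] proper_continuous_on_real(2)[OF g_cont]
  unfolding F_def[abs_def] G_def[abs_def] by auto

lemma \<rho>_nonneg: "0 \<le> \<rho>" using f_weakly_convex unfolding weakly_convex_on_def by auto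

lemma G_z: "G z < 0" using g_z g_G[OF z_in] by simp

lemma multiplier_bound_pos: "multiplier_bound > 0"
proof -
  have "M * D + \<rho>h * D\<^sup>2 > 0"
    using M_pos D_pos \<rho>_nonneg \<rho>h_gt by (intro add_pos_pos) auto
  then show ?thesis unfolding multiplier_bound_def using G_z by (intro divide_pos_pos) auto
qed

lemma F_subgradient: "\<lbrakk>y \<in> X; x \<in> X; \<zeta> \<in> frechet_subdiff f y\<rbrakk> \<Longrightarrow>
    F y + \<zeta> \<bullet> (x - y) - \<rho> / 2 * (norm (x - y))\<^sup>2 \<le> F x"
  using weakly_convex_on_real[OF f_cont f_weakly_convex, of y x \<zeta>] unfolding F_def by simp

lemma G_subgradient: "\<lbrakk>y \<in> X; x \<in> X; \<zeta> \<in> frechet_subdiff g y\<rbrakk> \<Longrightarrow> G y + \<zeta> \<bullet> (x - y) \<le> G x"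
  using weakly_convex_on_real[OF g_cont g_convex, of y x \<zeta>] unfolding G_def by simp

text \<open>Strong convexity with modulus \<open>\<rho>h - \<rho>\<close>: the squared distance
  contributes \<open>\<rho>h\<close> exactly, weak convexity of \<open>f\<close> takes away
  \<open>\<rho>\<close>.\<close>

lemma model_combination:
  assumes "y \<in> X" "y' \<in> X" "0 \<le> u" "u \<le> 1"
  shows "model x ((1 - u) *\<^sub>R y + u *\<^sub>R y') \<le>
    (1 - u) * model x y + u * model x y' - (\<rho>h - \<rho>) / 2 * (u * (1 - u) * (norm (y - y'))\<^sup>2)"
  using weakly_convex_on_combination[OF f_cont f_weakly_convex convex_X f_subdiff assms]
  unfolding model_def F_def[symmetric] norm_convex_combination_power2 by (simp add: field_simps)

lemma G_combination:
  assumes "y \<in> X" "y' \<in> X" "0 \<le> u" "u \<le> 1"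
  shows "G ((1 - u) *\<^sub>R y + u *\<^sub>R y') \<le> (1 - u) * G y + u * G y'"
  using weakly_convex_on_combination[OF g_cont g_convex convex_X g_subdiff assms]
  unfolding G_def[symmetric] by simp

text \<open>The feasible set is closed by continuity of \<open>G\<close>, bounded by the diameter of
  \<open>X\<close> and contains the Slater point, so the continuous model attains its minimum on
  it.\<close>

lemma prox_properties:
  shows prox_in: "prox x \<in> X" and G_prox: "G (prox x) \<le> 0"
    and prox_minimal: "\<And>y. y \<in> X \<Longrightarrow> G y \<le> 0 \<Longrightarrow> model x (prox x) \<le> model x y"
proof -
  define K where "K = {y \<in> X. G y \<le> 0}"
  let ?h = "\<lambda>y. f y + ereal (\<rho>h / 2 * (norm (y - x))\<^sup>2)"
  have h: "?h y = ereal (model x y)" if "y \<in> X" for y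
    unfolding model_def f_F[OF that] by simp
  have K_iff: "y \<in> X \<and> g y \<le> 0 \<longleftrightarrow> y \<in> K" for y
    unfolding K_def using g_G[of y] by (auto simp: zero_ereal_def)
  have "bounded X" using diameter unfolding bounded_def dist_norm by blast
  moreover have "closed K"
    unfolding K_def using continuous_closed_preimage[OF continuous_G closed_X, of "{..0}"]
    by (simp add: vimage_def Int_def)
  ultimately have "compact K" using closed_X bounded_subset[of X K]
    unfolding K_def compact_eq_bounded_closed by auto
  moreover have "K \<noteq> {}" unfolding K_def using z_in G_z by auto
  moreover have "continuous_on K (model x)"
    unfolding model_def by (intro continuous_intros continuous_on_subset[OF continuous_F]) (auto simp: K_def)
  ultimately obtain m where "m \<in> K" "\<forall>y\<in>K. model x m \<le> model x y"
    using continuous_attains_inf by metis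
  then have "is_arg_min ?h (\<lambda>y. y \<in> X \<and> g y \<le> 0) m"
    unfolding is_arg_min_def K_iff using h by (auto simp: K_def not_less)
  \<comment> \<open>\<open>arg_min\<close> is a Hilbert choice; it meets its specification because a
    minimiser has just been exhibited.\<close>
  then have "is_arg_min ?h (\<lambda>y. y \<in> X \<and> g y \<le> 0) (prox x)"
    unfolding prox_def constrained_prox_def arg_min_def by (rule someI)
  then have "prox x \<in> K" "\<And>y. y \<in> K \<Longrightarrow> \<not> ?h y < ?h (prox x)"
    unfolding is_arg_min_def K_iff by auto
  then show "prox x \<in> X" "G (prox x) \<le> 0" "\<And>y. y \<in> X \<Longrightarrow> G y \<le> 0 \<Longrightarrow> model x (prox x) \<le> model x y"
    using h by (auto simp: K_def not_less)
qed

text \<open>Points of the segment towards \<open>y\<close> are feasible by convexity of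
  \<open>G\<close>, so the minimiser does no worse than any of them, and strong convexity of the
  model supplies the quadratic gain.\<close>

lemma prox_growth:
  assumes "y \<in> X" "G y \<le> 0"
  shows "model x (prox x) + (\<rho>h - \<rho>) / 2 * (norm (y - prox x))\<^sup>2 \<le> model x y"
proof -
  have "u * ((\<rho>h - \<rho>) / 2 * (norm (y - prox x))\<^sup>2) \<le> model x y - model x (prox x)" if u: "0 < u" "u < 1" for u
  proof -
    let ?v = "1 - u"
    let ?w = "(1 - ?v) *\<^sub>R prox x + ?v *\<^sub>R y"
    have "?w \<in> X" using u prox_in assms convex_X by (intro convexD) auto
    moreover have "G ?w \<le> (1 - ?v) * G (prox x) + ?v * G y"
      using u prox_in assms by (intro G_combination) auto
    moreover have "\<dots> \<le> 0"
      using u G_prox[of x] assms(2) by (simp add: add_nonpos_nonpos mult_nonneg_nonpos)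
    ultimately have "model x (prox x) \<le> model x ?w" by (intro prox_minimal) auto
    also have "\<dots> \<le> (1 - ?v) * model x (prox x) + ?v * model x y
        - (\<rho>h - \<rho>) / 2 * (?v * (1 - ?v) * (norm (prox x - y))\<^sup>2)"
      using u prox_in assms by (intro model_combination) auto
    finally have "?v * (u * ((\<rho>h - \<rho>) / 2 * (norm (prox x - y))\<^sup>2)) \<le> ?v * (model x y - model x (prox x))"
      by (simp add: field_simps)
    then show ?thesis using u by (simp add: norm_minus_commute)
  qed
  \<comment> \<open>As \<open>u\<close> tends to 1 the comparison point tends to
    \<open>prox x\<close>; only this limit yields the full modulus.\<close>
  from field_le_mult_one_interval[OF this] show ?thesis by linarith
qed

text \<open>
  Applying the growth bound to the feasible convex combination of \<open>x\<close>
  and the Slater point replaces the Lagrange multiplier of the proximal problem.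
\<close>

lemma prox_penalty:
  assumes x: "x \<in> X"
  shows "F (prox x) + (\<rho>h / 2 + (\<rho>h - \<rho>) / 2) * (norm (prox x - x))\<^sup>2
    \<le> F x + multiplier_bound * max (G x) 0"
proof (cases "G x \<le> 0")
  case True
  show ?thesis using prox_growth[OF x True, of x] True
    unfolding model_def by (simp add: algebra_simps norm_minus_commute max_def)
next
  case False
  \<comment> \<open>This weight makes the convexity bound \<open>(1 - u) * G x + u * G z\<close>
    vanish, so the combination is feasible. The same identity later trades
    \<open>u * (- G z)\<close> for \<open>(1 - u) * G x\<close>, after which \<open>1 - u\<close>
    cancels.\<close>
  define u where "u = G x / (G x - G z)"
  have u: "0 < u" "u < 1" using False G_z unfolding u_def by (auto simp: field_simps)
  have uG: "u * (- G z) = (1 - u) * G x" using False G_z unfolding u_def by (auto simp: field_simps)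
  let ?w = "(1 - u) *\<^sub>R x + u *\<^sub>R z"
  let ?\<mu> = "(\<rho>h - \<rho>) / 2"
  have w: "?w \<in> X" using u x z_in convex_X by (intro convexD) auto
  have "G ?w \<le> (1 - u) * G x + u * G z" using u x z_in by (intro G_combination) auto
  also have "\<dots> = 0" using uG by simp
  finally have "model x (prox x) + ?\<mu> * (norm (?w - prox x))\<^sup>2 \<le> model x ?w" by (rule prox_growth[OF w])
  also have "\<dots> \<le> (1 - u) * model x x + u * model x z - ?\<mu> * (u * (1 - u) * (norm (x - z))\<^sup>2)"
    using u x z_in by (intro model_combination) auto
  finally have "model x (prox x) + ?\<mu> * ((1 - u) * (norm (x - prox x))\<^sup>2 + u * (norm (z - prox x))\<^sup>2)
      \<le> (1 - u) * model x x + u * model x z"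
    unfolding norm_convex_combination_power2 by (simp add: algebra_simps)
  moreover have "?\<mu> * (u * (norm (z - prox x))\<^sup>2) \<ge> 0" using u \<rho>h_gt by simp
  ultimately have 1: "(1 - u) * (model x (prox x) + ?\<mu> * (norm (x - prox x))\<^sup>2 - model x x)
      \<le> u * (model x z - model x (prox x))"
    by (simp add: field_simps)
  \<comment> \<open>A subgradient at the Slater point bounds the gap between the model values at
    \<open>z\<close> and at \<open>prox x\<close>. The quadratic terms cost
    \<open>\<rho> / 2\<close> and \<open>\<rho>h / 2\<close> times the square of \<open>D\<close>;
    with \<open>\<rho> < \<rho>h\<close> this gives the numerator of
    \<open>multiplier_bound\<close>.\<close>
  obtain \<zeta> where \<zeta>: "\<zeta> \<in> frechet_subdiff f z" using f_subdiff[OF z_in] by blast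
  have "F z - F (prox x) \<le> \<zeta> \<bullet> (z - prox x) + \<rho> / 2 * (norm (prox x - z))\<^sup>2"
    using F_subgradient[OF z_in prox_in[of x] \<zeta>] by (simp add: algebra_simps inner_diff_right)
  also have "\<dots> \<le> M * D + \<rho> / 2 * D\<^sup>2"
  proof (intro add_mono mult_left_mono power_mono)
    have "\<zeta> \<bullet> (z - prox x) \<le> norm \<zeta> * norm (z - prox x)" by (rule norm_cauchy_schwarz)
    also have "\<dots> \<le> M * D" using f_bound[OF z_in \<zeta>] diameter[OF z_in prox_in] M_pos
      by (intro mult_mono) auto
    finally show "\<zeta> \<bullet> (z - prox x) \<le> M * D" .
  qed (use \<rho>_nonneg diameter prox_in z_in in auto)
  moreover have "\<rho>h / 2 * (norm (z - x))\<^sup>2 \<le> \<rho>h / 2 * D\<^sup>2"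
    using \<rho>_nonneg \<rho>h_gt diameter[OF z_in x] by (intro mult_left_mono power_mono) auto
  moreover have "\<rho>h / 2 * (norm (prox x - x))\<^sup>2 \<ge> 0" using \<rho>_nonneg \<rho>h_gt by simp
  moreover have "\<rho> * D\<^sup>2 \<le> \<rho>h * D\<^sup>2" using \<rho>h_gt by (intro mult_right_mono) auto
  ultimately have "model x z - model x (prox x) \<le> M * D + \<rho>h * D\<^sup>2"
    unfolding model_def by (simp add: algebra_simps)
  then have "u * (model x z - model x (prox x)) \<le> u * (M * D + \<rho>h * D\<^sup>2)"
    using u by simp
  also have "\<dots> = u * (- G z) * multiplier_bound"
    unfolding multiplier_bound_def using G_z by simp
  also have "\<dots> = (1 - u) * (multiplier_bound * G x)" unfolding uG by simp
  finally have "(1 - u) * (model x (prox x) + ?\<mu> * (norm (x - prox x))\<^sup>2 - model x x)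
      \<le> (1 - u) * (multiplier_bound * G x)" using 1 by linarith
  then have "model x (prox x) + ?\<mu> * (norm (x - prox x))\<^sup>2 - model x x \<le> multiplier_bound * G x"
    using u by simp
  then show ?thesis using False unfolding model_def
    by (simp add: algebra_simps norm_minus_commute max_def)
qed

text \<open>The modulus collects \<open>\<rho>h / 2\<close> from the proximal term and
  \<open>(\<rho>h - \<rho>) / 2\<close> from quadratic growth, less the \<open>\<rho> / 2\<close>
  lost in the subgradient inequality at \<open>x\<close>.\<close>

lemma f_subgradient_towards_prox:
  assumes x: "x \<in> X" and \<zeta>: "\<zeta> \<in> frechet_subdiff f x"
  shows "\<zeta> \<bullet> (prox x - x) \<le> multiplier_bound * max (G x) 0 - (\<rho>h - \<rho>) * (norm (prox x - x))\<^sup>2"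
  using F_subgradient[OF x prox_in[of x] \<zeta>] prox_penalty[OF x] by (simp add: field_simps)

lemma g_subgradient_towards_prox:
  assumes x: "x \<in> X" and \<zeta>: "\<zeta> \<in> frechet_subdiff g x"
  shows "\<zeta> \<bullet> (prox x - x) \<le> - G x"
  using G_subgradient[OF x prox_in[of x] \<zeta>] G_prox[of x] by linarith

text \<open>The Moreau envelope, with parameter \<open>1 / \<rho>h\<close>, of \<open>f\<close>
  restricted to the feasible set. It serves as the Lyapunov function of the method.\<close>

definition envelope :: "'a \<Rightarrow> real" where "envelope x = model x (prox x)"

text \<open>The old proximal point is kept as a trial point for the new problem. It lies in
  \<open>X\<close>, so the projection fixes it and, being nonexpansive, does not increase the
  distance to it; expanding the square gives the two terms.\<close>

lemma envelope_step:
  assumes "x \<in> X"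
  shows "envelope (closest_point X (x - s *\<^sub>R v)) \<le>
    envelope x + \<rho>h * (s * (v \<bullet> (prox x - x)) + s\<^sup>2 * (norm v)\<^sup>2 / 2)"
proof -
  let ?x' = "closest_point X (x - s *\<^sub>R v)"
  have "norm (prox x - ?x') \<le> norm (prox x - (x - s *\<^sub>R v))"
    using closest_point_lipschitz[OF convex_X closed_X, of "prox x" "x - s *\<^sub>R v"]
      closest_point_self[OF prox_in] prox_in by (auto simp: dist_norm)
  then have "(norm (prox x - ?x'))\<^sup>2 \<le> (norm (prox x - (x - s *\<^sub>R v)))\<^sup>2" by (intro power_mono) auto
  also have "\<dots> = (norm (prox x - x))\<^sup>2 + 2 * s * (v \<bullet> (prox x - x)) + s\<^sup>2 * (norm v)\<^sup>2"
    unfolding power2_norm_eq_inner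
    by (simp add: inner_diff_left inner_diff_right inner_add_left inner_add_right
      inner_commute algebra_simps power2_eq_square)
  finally have "\<rho>h / 2 * (norm (prox x - ?x'))\<^sup>2 \<le>
      \<rho>h / 2 * ((norm (prox x - x))\<^sup>2 + 2 * s * (v \<bullet> (prox x - x)) + s\<^sup>2 * (norm v)\<^sup>2)"
    using \<rho>_nonneg \<rho>h_gt by (intro mult_left_mono) auto
  moreover have "envelope ?x' \<le> model ?x' (prox x)"
    unfolding envelope_def using prox_in G_prox by (intro prox_minimal) auto
  ultimately show ?thesis unfolding envelope_def model_def by (simp add: algebra_simps)
qed

text \<open>Trying \<open>prox y\<close> in the problem at \<open>x\<close> leaves the
  \<open>F\<close> part unchanged, so the values differ by proximal terms only and the variation of
  \<open>F\<close> over \<open>X\<close> does not enter.\<close>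

lemma envelope_oscillation:
  assumes "x \<in> X"
  shows "envelope x \<le> envelope y + \<rho>h * (D\<^sup>2 / 2)"
proof -
  have "envelope x \<le> model x (prox y)"
    unfolding envelope_def using prox_in G_prox by (intro prox_minimal) auto
  also have "\<dots> \<le> F (prox y) + \<rho>h / 2 * D\<^sup>2"
    unfolding model_def using \<rho>_nonneg \<rho>h_gt diameter[OF prox_in assms]
    by (intro add_left_mono mult_left_mono power_mono) auto
  also have "\<dots> \<le> envelope y + \<rho>h * (D\<^sup>2 / 2)"
    unfolding envelope_def model_def using \<rho>_nonneg \<rho>h_gt by simp
  finally show ?thesis .
qed

text \<open>In the sum of the growth inequalities at the two proximal points the values of
  \<open>F\<close> cancel and the squares collapse to an inner product. The resulting continuity of
  \<open>prox\<close> is what makes the noise terms measurable.\<close>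

lemma prox_lipschitz: "norm (prox x - prox y) \<le> \<rho>h / (\<rho>h - \<rho>) * norm (x - y)"
proof -
  let ?p = "prox x" and ?q = "prox y"
  have "model x ?p + (\<rho>h - \<rho>) / 2 * (norm (?q - ?p))\<^sup>2 \<le> model x ?q"
    "model y ?q + (\<rho>h - \<rho>) / 2 * (norm (?p - ?q))\<^sup>2 \<le> model y ?p"
    by (rule prox_growth[OF prox_in G_prox])+
  then have "(\<rho>h - \<rho>) * (norm (?p - ?q))\<^sup>2 \<le>
      \<rho>h / 2 * ((norm (?q - x))\<^sup>2 - (norm (?q - y))\<^sup>2 + (norm (?p - y))\<^sup>2 - (norm (?p - x))\<^sup>2)"
    unfolding model_def by (simp add: field_simps norm_minus_commute)
  also have "\<dots> = \<rho>h * ((?p - ?q) \<bullet> (x - y))"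
    by (simp add: power2_norm_eq_inner inner_diff_left inner_diff_right inner_commute algebra_simps)
  also have "\<dots> \<le> \<rho>h * (norm (?p - ?q) * norm (x - y))"
    using \<rho>_nonneg \<rho>h_gt norm_cauchy_schwarz by (intro mult_left_mono) auto
  finally have "norm (?p - ?q) * ((\<rho>h - \<rho>) * norm (?p - ?q)) \<le> norm (?p - ?q) * (\<rho>h * norm (x - y))"
    by (simp add: algebra_simps power2_eq_square)
  then have "(\<rho>h - \<rho>) * norm (?p - ?q) \<le> \<rho>h * norm (x - y) \<or> norm (?p - ?q) = 0"
    by (auto simp: mult_le_cancel_left)
  moreover have "0 \<le> \<rho>h * norm (x - y)" using \<rho>_nonneg \<rho>h_gt by simp
  ultimately have "(\<rho>h - \<rho>) * norm (?p - ?q) \<le> \<rho>h * norm (x - y)" by (metis mult_zero_right)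
  then show ?thesis using \<rho>h_gt by (simp add: field_simps)
qed

lemma continuous_prox: "continuous_on A prox"
proof -
  have "0 \<le> \<rho>h / (\<rho>h - \<rho>)" using \<rho>_nonneg \<rho>h_gt by simp
  then have "(\<rho>h / (\<rho>h - \<rho>))-lipschitz_on A prox"
    using prox_lipschitz by (intro lipschitz_onI) (auto simp: dist_norm)
  then show ?thesis by (rule lipschitz_on_continuous_on)
qed

end

section \<open>Exponential moments\<close>

text \<open>For a centred variable the linear term integrates to 0, so an exponential moment of the
  square controls that of the variable itself.\<close>

lemma exp_le_add_exp_square: "exp x \<le> x + exp (x\<^sup>2)" for x :: real
proof -
  have sq: "1 + x\<^sup>2 \<le> exp (x\<^sup>2)" by (rule exp_ge_add_one_self)
  consider "x \<le> -1" | "-1 \<le> x" "x \<le> 0" | "0 \<le> x" "x \<le> 1" | "1 \<le> x" by linarith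
  then show ?thesis
  proof cases
    case 1
    then have "x * (x + 1) \<ge> 0" by (simp add: mult_nonpos_nonpos)
    then have "- x \<le> x\<^sup>2" by (simp add: power2_eq_square algebra_simps)
    moreover have "exp x \<le> 1" using 1 by simp
    ultimately show ?thesis using sq by linarith
  next
    case 2
    define y where "y = - x"
    have y: "0 \<le> y" "y \<le> 1" using 2 unfolding y_def by auto
    \<comment> \<open>Since \<open>exp y\<close> dominates the second factor, this makes the first
      factor an upper bound of \<open>exp (- y)\<close>.\<close>
    have "1 \<le> (1 - y + y\<^sup>2) * (1 + y + y\<^sup>2 / 2)"
    proof -
      have "(1 - y + y\<^sup>2) * (1 + y + y\<^sup>2 / 2) = 1 + (y\<^sup>2 + y ^ 3 + y ^ 4) / 2"
        by (simp add: power2_eq_square power3_eq_cube power4_eq_xxxx field_simps)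
      then show ?thesis using y by simp
    qed
    also have "\<dots> \<le> (1 - y + y\<^sup>2) * exp y"
      using y by (intro mult_left_mono exp_lower_Taylor_quadratic) auto
    finally have "exp (- y) \<le> 1 - y + y\<^sup>2"
      by (simp add: exp_minus inverse_eq_divide pos_divide_le_eq)
    then have "exp x \<le> 1 + x + x\<^sup>2" unfolding y_def by simp
    then show ?thesis using sq by linarith
  next
    case 3
    then have "exp x \<le> x + (1 + x\<^sup>2)" using exp_bound[of x] by simp
    also have "\<dots> \<le> x + exp (x\<^sup>2)" by (intro add_left_mono sq)
    finally show ?thesis .
  next
    case 4
    then have "x \<le> x\<^sup>2" by (simp add: power2_eq_square)
    then have "exp x \<le> exp (x\<^sup>2)" by simp
    then show ?thesis using 4 by linarith
  qed
qed

text \<open>Jensen's inequality for the power \<open>a\<close>, obtained from a pointwise bound: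
  \<open>exp\<close> is convex between 0 and \<open>s - 1\<close>, and the shift by 1 is chosen so
  that the bracket integrates to at most 1 when the moment of \<open>exp (u v)\<close> is at most
  \<open>exp 1\<close>.\<close>

lemma exp_moment_power:
  fixes u :: "'a \<Rightarrow> real"
  assumes "prob_space Q" and [measurable]: "u \<in> borel_measurable Q"
    and u: "(\<integral>\<^sup>+v. ennreal (exp (u v)) \<partial>Q) \<le> ennreal (exp 1)" and a: "0 \<le> a" "a \<le> 1"
  shows "(\<integral>\<^sup>+v. ennreal (exp (a * u v)) \<partial>Q) \<le> ennreal (exp a)"
proof -
  interpret prob_space Q by fact
  have bound: "exp (a * s) \<le> exp a * ((1 - a) + a * exp (-1) * exp s)" for s :: real
  proof -
    have "exp (a * (s - 1)) = exp ((1 - a) *\<^sub>R 0 + a *\<^sub>R (s - 1))" by simp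
    also have "\<dots> \<le> (1 - a) * exp 0 + a * exp (s - 1)"
      using convex_onD[OF exp_convex, of a 0 "s - 1"] a by simp
    finally have "exp (a * (s - 1)) \<le> (1 - a) + a * exp (-1) * exp s" 
      by (simp add: exp_diff exp_minus field_simps)
    then have "exp a * exp (a * (s - 1)) \<le> exp a * ((1 - a) + a * exp (-1) * exp s)" by simp
    moreover have "exp a * exp (a * (s - 1)) = exp (a * s)"
      unfolding exp_add[symmetric] by (simp add: algebra_simps)
    ultimately show ?thesis by simp
  qed
  have "(\<integral>\<^sup>+v. ennreal (exp (a * u v)) \<partial>Q)
      \<le> (\<integral>\<^sup>+v. ennreal (exp a * (1 - a)) + ennreal (exp a * a * exp (-1)) * ennreal (exp (u v)) \<partial>Q)"
    using bound a
    by (intro nn_integral_mono)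
      (simp add: ennreal_mult[symmetric] ennreal_plus[symmetric] distrib_left mult.assoc ennreal_leI del: ennreal_plus)
  also have "\<dots> = ennreal (exp a * (1 - a)) + ennreal (exp a * a * exp (-1)) * (\<integral>\<^sup>+v. ennreal (exp (u v)) \<partial>Q)"
    by (simp add: nn_integral_add nn_integral_cmult emeasure_space_1)
  also have "\<dots> \<le> ennreal (exp a * (1 - a)) + ennreal (exp a * a * exp (-1)) * ennreal (exp 1)"
    using u by (intro add_left_mono mult_left_mono) auto
  also have "\<dots> = ennreal (exp a)"
    using a by (simp add: ennreal_mult[symmetric] ennreal_plus[symmetric] exp_minus field_simps del: ennreal_plus)
  finally show ?thesis .
qed

text \<open>A sub-Gaussian estimate. The square of the centred variable is at most
  \<open>s * ((u v + 1) / 2)\<close>, and \<open>(u v + 1) / 2\<close> inherits the light tail. For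
  \<open>s \<le> 1\<close> this moment is available directly; for larger \<open>s\<close> a fixed
  fraction of it suffices.\<close>

lemma centred_inner_mgf_bound:
  fixes q :: "'a::euclidean_space"
  assumes "prob_space Q" and sets_Q[measurable_cong]: "sets Q = sets borel"
    and int: "integrable Q (\<lambda>v. v)" and M: "M > 0" and mean: "norm (\<integral>v. v \<partial>Q) \<le> M"
    and light: "(\<integral>\<^sup>+v. ennreal (exp ((norm v)\<^sup>2 / M\<^sup>2)) \<partial>Q) \<le> ennreal (exp 1)"
  shows "(\<integral>\<^sup>+v. ennreal (exp ((v - (\<integral>v. v \<partial>Q)) \<bullet> q)) \<partial>Q) \<le> ennreal (exp (4 * M\<^sup>2 * (norm q)\<^sup>2))"
proof -
  interpret prob_space Q by fact
  define m where "m = (\<integral>v. v \<partial>Q)"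
  \<comment> \<open>One factor 2 comes from \<open>(a + b)^2 \<le> 2 * (a^2 + b^2)\<close>, the
    other from halving \<open>u v + 1\<close> so that its exponential moment is again at most
    \<open>exp 1\<close>.\<close>
  define s where "s = 4 * M\<^sup>2 * (norm q)\<^sup>2"
  define u where "u v = (norm v)\<^sup>2 / M\<^sup>2" for v :: 'a
  define X where "X v = (v - m) \<bullet> q" for v
  have [measurable]: "u \<in> borel_measurable Q" "X \<in> borel_measurable Q"
    unfolding u_def X_def by measurable
  have s0: "0 \<le> s" unfolding s_def by simp
  have X2: "(X v)\<^sup>2 \<le> s * ((u v + 1) / 2)" for v
  proof -
    have "\<bar>X v\<bar> \<le> norm (v - m) * norm q" unfolding X_def by (rule Cauchy_Schwarz_ineq2)
    also have "norm (v - m) * norm q \<le> (norm v + M) * norm q"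
      using mean norm_triangle_ineq4[of v m] unfolding m_def by (intro mult_right_mono) auto
    finally have "\<bar>X v\<bar> ^ 2 \<le> ((norm v + M) * norm q)\<^sup>2" by (intro power_mono) auto
    also have "\<dots> = (norm v + M)\<^sup>2 * (norm q)\<^sup>2" by (simp add: power_mult_distrib)
    also have "\<dots> \<le> (2 * ((norm v)\<^sup>2 + M\<^sup>2)) * (norm q)\<^sup>2"
      using sum_squares_bound[of "norm v" M] by (intro mult_right_mono) (auto simp: power2_sum)
    also have "\<dots> = s * ((u v + 1) / 2)"
      unfolding s_def u_def using M by (simp add: field_simps)
    finally show ?thesis by simp
  qed
  have light': "(\<integral>\<^sup>+v. ennreal (exp (u v)) \<partial>Q) \<le> ennreal (exp 1)" using light unfolding u_def .
  have mgf: "(\<integral>\<^sup>+v. ennreal (exp (a * ((u v + 1) / 2))) \<partial>Q) \<le> ennreal (exp a)" if "0 \<le> a" "a \<le> 1" for a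
  proof -
    have "(\<integral>\<^sup>+v. ennreal (exp (a * ((u v + 1) / 2))) \<partial>Q) =
        (\<integral>\<^sup>+v. ennreal (exp (a / 2)) * ennreal (exp ((a / 2) * u v)) \<partial>Q)"
      by (intro nn_integral_cong) (simp add: ennreal_mult[symmetric] exp_add[symmetric] field_simps)
    also have "\<dots> = ennreal (exp (a / 2)) * (\<integral>\<^sup>+v. ennreal (exp ((a / 2) * u v)) \<partial>Q)"
      by (rule nn_integral_cmult) measurable
    also have "\<dots> \<le> ennreal (exp (a / 2)) * ennreal (exp (a / 2))"
      using that by (intro mult_left_mono exp_moment_power[OF prob_space_axioms _ light']) auto
    also have "\<dots> = ennreal (exp a)" by (simp add: ennreal_mult[symmetric] exp_add[symmetric])
    finally show ?thesis .
  qed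
  have "(\<integral>\<^sup>+v. ennreal (exp (X v)) \<partial>Q) \<le> ennreal (exp s)"
  proof (cases "s \<le> 1")
    case True
    have "(\<integral>\<^sup>+v. ennreal (exp ((X v)\<^sup>2)) \<partial>Q) \<le> (\<integral>\<^sup>+v. ennreal (exp (s * ((u v + 1) / 2))) \<partial>Q)"
      using X2 by (intro nn_integral_mono ennreal_leI) auto
    also have "\<dots> \<le> ennreal (exp s)" using mgf[OF s0 True] .
    finally have sq: "(\<integral>\<^sup>+v. ennreal (exp ((X v)\<^sup>2)) \<partial>Q) \<le> ennreal (exp s)" .
    have int_sq: "integrable Q (\<lambda>v. exp ((X v)\<^sup>2))"
      using sq by (intro integrableI_nonneg) (auto intro: le_less_trans)
    have int_X: "integrable Q X" unfolding X_def using int by auto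
    have X0: "(\<integral>v. X v \<partial>Q) = 0"
      unfolding X_def using int by (simp add: m_def prob_space)
    have int_exp: "integrable Q (\<lambda>v. exp (X v))"
      by (intro Bochner_Integration.integrable_bound[OF Bochner_Integration.integrable_add[OF int_X int_sq]])
        (auto intro!: AE_I2 order_trans[OF exp_le_add_exp_square abs_ge_self])
    have "(\<integral>v. exp (X v) \<partial>Q) \<le> (\<integral>v. X v + exp ((X v)\<^sup>2) \<partial>Q)"
      using int_exp int_X int_sq exp_le_add_exp_square by (intro integral_mono) auto
    also have "\<dots> = (\<integral>v. exp ((X v)\<^sup>2) \<partial>Q)" using X0 int_X int_sq by simp
    finally have "ennreal (\<integral>v. exp (X v) \<partial>Q) \<le> ennreal (\<integral>v. exp ((X v)\<^sup>2) \<partial>Q)" by (rule ennreal_leI)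
    then show ?thesis using sq
      by (simp add: nn_integral_eq_integral[OF int_exp] nn_integral_eq_integral[OF int_sq])
  next
    \<comment> \<open>Young's inequality with weight \<open>s\<close> leaves only a quarter of
      \<open>u v + 1\<close>, at the price \<open>s / 2\<close>. The total exponent
      \<open>s / 2 + 1 / 2\<close> is below \<open>s\<close> exactly because
      \<open>s > 1\<close>.\<close>
    case False
    have "X v \<le> s / 2 + (1 / 2) * ((u v + 1) / 2)" for v
    proof -
      have "2 * s * X v \<le> s\<^sup>2 + (X v)\<^sup>2" by (rule sum_squares_bound)
      also have "\<dots> \<le> s\<^sup>2 + s * ((u v + 1) / 2)" using X2 by simp
      finally have "s * (2 * X v) \<le> s * (s + (u v + 1) / 2)" by (simp add: power2_eq_square algebra_simps)
      then show ?thesis using False by simp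
    qed
    then have "(\<integral>\<^sup>+v. ennreal (exp (X v)) \<partial>Q) \<le>
        (\<integral>\<^sup>+v. ennreal (exp (s / 2)) * ennreal (exp ((1 / 2) * ((u v + 1) / 2))) \<partial>Q)"
      by (intro nn_integral_mono) (auto simp: ennreal_mult[symmetric] exp_add[symmetric] intro!: ennreal_leI)
    also have "\<dots> = ennreal (exp (s / 2)) * (\<integral>\<^sup>+v. ennreal (exp ((1 / 2) * ((u v + 1) / 2))) \<partial>Q)"
      by (rule nn_integral_cmult) measurable
    also have "\<dots> \<le> ennreal (exp (s / 2)) * ennreal (exp (1 / 2))"
      by (intro mult_left_mono mgf) auto
    also have "\<dots> = ennreal (exp (s / 2 + 1 / 2))" by (simp add: ennreal_mult[symmetric] exp_add[symmetric])
    also have "\<dots> \<le> ennreal (exp s)" using False by (intro ennreal_leI) auto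
    finally show ?thesis .
  qed
  then show ?thesis unfolding X_def s_def m_def .
qed

section \<open>Integration against a conditional law known on events\<close>

text \<open>
  \<open>w \<mapsto> K w\<close> is not assumed to be measurable, so \<open>w \<mapsto> \<integral>\<^sup>+v. k (w, v) \<partial>K w\<close> need not be
  measurable either; it agrees almost everywhere with a measurable function.
\<close>

lemma cond_law_emeasure:
  fixes \<xi> :: "'s \<Rightarrow> 'a::euclidean_space" and K :: "'s \<Rightarrow> 'a measure"
  assumes "prob_space P" and sub: "subalgebra P F" and \<xi>[measurable]: "\<xi> \<in> borel_measurable P"
    and K: "\<And>w. w \<in> space P \<Longrightarrow> prob_space (K w)" "\<And>w. w \<in> space P \<Longrightarrow> sets (K w) = sets borel"
    and law: "\<And>A. A \<in> sets borel \<Longrightarrow>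
      AE w in P. real_cond_exp P F (indicator {w \<in> space P. \<xi> w \<in> A}) w = measure (K w) A"
    and A: "A \<in> sets (F \<Otimes>\<^sub>M borel)"
  shows "\<exists>h\<in>borel_measurable F. (AE w in P. h w = (\<integral>\<^sup>+v. indicator A (w, v) \<partial>K w)) \<and>
    (\<integral>\<^sup>+w. h w \<partial>P) = (\<integral>\<^sup>+w. indicator A (w, \<xi> w) \<partial>P)"
proof -
  interpret prob_space P by fact
  interpret finite_measure_subalgebra P F by standard (rule sub)
  have space_F: "space F = space P" using sub unfolding subalgebra_def by simp
  have F_P: "h \<in> borel_measurable F \<Longrightarrow> h \<in> borel_measurable P" for h :: "'s \<Rightarrow> ennreal"
    using measurable_from_subalg[OF sub] .
  have id_F[measurable]: "(\<lambda>w. w) \<in> measurable P F"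
    using sub unfolding subalgebra_def by (intro measurableI) (auto intro: subsetD sets.sets_into_space)
  have meas_P[measurable]: "(\<lambda>w. (w, \<xi> w)) \<in> measurable P (F \<Otimes>\<^sub>M borel)" by measurable
  have meas_K: "Pair w \<in> measurable (K w) (F \<Otimes>\<^sub>M borel)" if "w \<in> space P" for w
  proof -
    have "w \<in> space F" using that space_F by simp
    then show ?thesis using K(2)[OF that] by (simp cong: measurable_cong_sets)
  qed
  show ?thesis
    \<comment> \<open>Dynkin's argument from rectangles. The measurable version \<open>h\<close> is
      carried through each closure operation, since the kernel integral cannot serve as its own
      witness.\<close>
    using Int_stable_pair_measure_generator pair_measure_closed A unfolding sets_pair_measure
  proof (induction A rule: sigma_sets_induct_disjoint)
    case (basic A)
    then obtain B C where A: "A = B \<times> C" and B: "B \<in> sets F" and C[measurable]: "C \<in> sets borel" by auto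
    let ?c = "real_cond_exp P F (indicator {w \<in> space P. \<xi> w \<in> C})"
    have [measurable]: "B \<in> sets P" using B sub unfolding subalgebra_def by auto
    have int: "integrable P (indicator {w \<in> space P. \<xi> w \<in> C} :: _ \<Rightarrow> real)"
      by (intro integrable_real_indicator) (auto simp: less_top[symmetric])
    have intB: "integrable P (\<lambda>w. indicator B w * u w)" if "integrable P u" for u :: "'s \<Rightarrow> real"
      using integrable_mult_indicator[OF \<open>B \<in> sets P\<close> that] by simp
    show ?case
    \<comment> \<open>On a rectangle the witness is the conditional probability cut down to
      \<open>B\<close>: \<open>law\<close> identifies it with the kernel value, and testing the
      conditional expectation on \<open>B\<close> gives the integral.\<close>
    proof (intro bexI[of _ "\<lambda>w. indicator B w * ennreal (?c w)"] conjI)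
      have "AE w in P. w \<in> space P" by (rule AE_space)
      with law[OF C] show "AE w in P. indicator B w * ennreal (?c w) = (\<integral>\<^sup>+v. indicator A (w, v) \<partial>K w)"
      proof eventually_elim
        case (elim w)
        interpret K: prob_space "K w" using K elim by auto
        have "(\<integral>\<^sup>+v. indicator A (w, v) \<partial>K w) = (\<integral>\<^sup>+v. indicator B w * indicator C v \<partial>K w)"
          unfolding A by (simp add: indicator_times)
        also have "\<dots> = indicator B w * emeasure (K w) C"
          using elim C by (intro nn_integral_cmult_indicator) (simp add: K(2))
        finally show ?case using elim by (simp add: K.emeasure_eq_measure)
      qed
      have "AE w in P. 0 \<le> ?c w" using int by (intro real_cond_exp_pos) auto
      then have cpos: "AE w in P. 0 \<le> indicator B w * ?c w" by eventually_elim simp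
      have "(\<integral>\<^sup>+w. indicator B w * ennreal (?c w) \<partial>P) = (\<integral>\<^sup>+w. ennreal (indicator B w * ?c w) \<partial>P)"
        by (intro nn_integral_cong) (auto split: split_indicator)
      also have "\<dots> = ennreal (\<integral>w. indicator B w * ?c w \<partial>P)"
        by (intro nn_integral_eq_integral intB real_cond_exp_int(1)[OF int] cpos)
      also have "(\<integral>w. indicator B w * ?c w \<partial>P) = (\<integral>w. indicator B w * indicator {w \<in> space P. \<xi> w \<in> C} w \<partial>P)"
        using real_cond_exp_intA[OF int B] unfolding set_lebesgue_integral_def by simp
      also have "ennreal \<dots> = (\<integral>\<^sup>+w. ennreal (indicator B w * indicator {w \<in> space P. \<xi> w \<in> C} w) \<partial>P)"
        by (intro nn_integral_eq_integral[symmetric] intB int) simp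
      also have "\<dots> = (\<integral>\<^sup>+w. indicator A (w, \<xi> w) \<partial>P)"
        unfolding A by (intro nn_integral_cong) (auto split: split_indicator)
      finally show "(\<integral>\<^sup>+w. indicator B w * ennreal (?c w) \<partial>P) = (\<integral>\<^sup>+w. indicator A (w, \<xi> w) \<partial>P)" .
      show "(\<lambda>w. indicator B w * ennreal (?c w)) \<in> borel_measurable F"
        using B borel_measurable_cond_exp by measurable
    qed
  next
    case empty
    show ?case by (intro bexI[of _ "\<lambda>_. 0"]) auto
  next
    case (compl A)
    let ?\<Omega> = "space F \<times> space borel :: ('s \<times> 'a) set"
    have A[measurable]: "A \<in> sets (F \<Otimes>\<^sub>M borel)" using compl.hyps by (simp add: sets_pair_measure)
    from compl.IH obtain h where [measurable]: "h \<in> borel_measurable F"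
      and h: "AE w in P. h w = (\<integral>\<^sup>+v. indicator A (w, v) \<partial>K w)"
      and h_int: "(\<integral>\<^sup>+w. h w \<partial>P) = (\<integral>\<^sup>+w. indicator A (w, \<xi> w) \<partial>P)" by blast
    have [measurable]: "h \<in> borel_measurable P" by (rule F_P) fact
    have K_int: "(\<integral>\<^sup>+v. indicator (?\<Omega> - A) (w, v) \<partial>K w) = 1 - (\<integral>\<^sup>+v. indicator A (w, v) \<partial>K w)"
      "(\<integral>\<^sup>+v. indicator A (w, v) \<partial>K w) \<le> 1" if "w \<in> space P" for w
    proof -
      interpret K: prob_space "K w" using K that by auto
      have m[measurable]: "(\<lambda>v. indicator A (w, v) :: ennreal) \<in> borel_measurable (K w)"
        using measurable_compose[OF meas_K[OF that] borel_measurable_indicator[OF A]] .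
      have "(\<integral>\<^sup>+v. indicator A (w, v) \<partial>K w) \<le> (\<integral>\<^sup>+v. 1 \<partial>K w)"
        by (intro nn_integral_mono) (auto split: split_indicator)
      then show le: "(\<integral>\<^sup>+v. indicator A (w, v) \<partial>K w) \<le> 1" by (simp add: K.emeasure_space_1)
      have "(\<integral>\<^sup>+v. indicator (?\<Omega> - A) (w, v) \<partial>K w) = (\<integral>\<^sup>+v. 1 - indicator A (w, v) \<partial>K w)"
        using that space_F by (intro nn_integral_cong) (simp add: indicator_def)
      also have "\<dots> = (\<integral>\<^sup>+v. 1 \<partial>K w) - (\<integral>\<^sup>+v. indicator A (w, v) \<partial>K w)"
      proof (rule nn_integral_diff)
        show "(\<integral>\<^sup>+v. indicator A (w, v) \<partial>K w) \<noteq> \<infinity>"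
          using le_less_trans[OF le ennreal_one_less_top] by simp
        show "AE v in K w. indicator A (w, v) \<le> (1 :: ennreal)" by (simp add: indicator_def)
      qed (simp_all add: m)
      finally show "(\<integral>\<^sup>+v. indicator (?\<Omega> - A) (w, v) \<partial>K w) = 1 - (\<integral>\<^sup>+v. indicator A (w, v) \<partial>K w)"
        by (simp add: K.emeasure_space_1)
    qed
    have h1: "AE w in P. h w = (\<integral>\<^sup>+v. indicator A (w, v) \<partial>K w) \<and> h w \<le> 1"
      using h AE_space by eventually_elim (auto simp: K_int)
    have le1: "(\<integral>\<^sup>+w. h w \<partial>P) \<le> 1"
    proof -
      have "(\<integral>\<^sup>+w. h w \<partial>P) \<le> (\<integral>\<^sup>+w. 1 \<partial>P)" using h1 by (intro nn_integral_mono_AE) auto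
      then show ?thesis by (simp add: emeasure_space_1)
    qed
    show ?case
    proof (intro bexI[of _ "\<lambda>w. 1 - h w"] conjI)
      show "AE w in P. 1 - h w = (\<integral>\<^sup>+v. indicator (?\<Omega> - A) (w, v) \<partial>K w)"
        using h1 AE_space
      proof eventually_elim
        case (elim w)
        then show ?case using K_int(1)[of w] by simp
      qed
      have "(\<integral>\<^sup>+w. 1 - h w \<partial>P) = (\<integral>\<^sup>+w. 1 \<partial>P) - (\<integral>\<^sup>+w. h w \<partial>P)"
      proof (rule nn_integral_diff)
        show "(\<integral>\<^sup>+w. h w \<partial>P) \<noteq> \<infinity>" using le_less_trans[OF le1 ennreal_one_less_top] by simp
        show "AE w in P. h w \<le> 1" using h1 by eventually_elim (rule conjunct2)
      qed measurable
      also have "\<dots> = (\<integral>\<^sup>+w. 1 \<partial>P) - (\<integral>\<^sup>+w. indicator A (w, \<xi> w) \<partial>P)" unfolding h_int ..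
      also have "\<dots> = (\<integral>\<^sup>+w. 1 - indicator A (w, \<xi> w) \<partial>P)"
      proof (rule nn_integral_diff[symmetric])
        show "(\<integral>\<^sup>+w. indicator A (w, \<xi> w) \<partial>P) \<noteq> \<infinity>"
          using le_less_trans[OF le1[unfolded h_int] ennreal_one_less_top] by simp
        show "AE w in P. indicator A (w, \<xi> w) \<le> (1 :: ennreal)" by (simp add: indicator_def)
      qed measurable
      also have "\<dots> = (\<integral>\<^sup>+w. indicator (?\<Omega> - A) (w, \<xi> w) \<partial>P)"
        using space_F by (intro nn_integral_cong) (auto split: split_indicator)
      finally show "(\<integral>\<^sup>+w. 1 - h w \<partial>P) = (\<integral>\<^sup>+w. indicator (?\<Omega> - A) (w, \<xi> w) \<partial>P)" .
    qed measurable
  next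
    case (union A)
    have A[measurable]: "A i \<in> sets (F \<Otimes>\<^sub>M borel)" for i using union.hyps by (auto simp: sets_pair_measure)
    define R where "R i h \<longleftrightarrow> h \<in> borel_measurable F \<and> (AE w in P. h w = (\<integral>\<^sup>+v. indicator (A i) (w, v) \<partial>K w)) \<and>
      (\<integral>\<^sup>+w. h w \<partial>P) = (\<integral>\<^sup>+w. indicator (A i) (w, \<xi> w) \<partial>P)" for i h
    have "\<forall>i. \<exists>h. R i h" using union.IH unfolding R_def Bex_def by (rule allI)
    from choice[OF this] obtain h where R: "\<forall>i. R i (h i)" ..
    have [measurable]: "\<And>i. h i \<in> borel_measurable F"
      and h: "\<And>i. AE w in P. h i w = (\<integral>\<^sup>+v. indicator (A i) (w, v) \<partial>K w)"
      and h_int: "\<And>i. (\<integral>\<^sup>+w. h i w \<partial>P) = (\<integral>\<^sup>+w. indicator (A i) (w, \<xi> w) \<partial>P)"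
      using R unfolding R_def by simp_all
    have [measurable]: "h i \<in> borel_measurable P" for i by (rule F_P) fact
    have ind: "(indicator (\<Union>i. A i) y :: ennreal) = (\<Sum>i. indicator (A i) y)" for y
      by (rule suminf_indicator[OF union.hyps(1), symmetric])
    have h': "AE w in P. \<forall>i. h i w = (\<integral>\<^sup>+v. indicator (A i) (w, v) \<partial>K w)"
      using h by (simp add: AE_all_countable)
    show ?case
    proof (intro bexI[of _ "\<lambda>w. \<Sum>i. h i w"] conjI)
      show "AE w in P. (\<Sum>i. h i w) = (\<integral>\<^sup>+v. indicator (\<Union>i. A i) (w, v) \<partial>K w)"
        using h' AE_space
      proof eventually_elim
        case (elim w)
        have m: "(\<lambda>v. indicator (A i) (w, v) :: ennreal) \<in> borel_measurable (K w)" for i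
          using measurable_compose[OF meas_K[OF elim(2)] borel_measurable_indicator[OF A]] .
        have "(\<Sum>i. h i w) = (\<Sum>i. \<integral>\<^sup>+v. indicator (A i) (w, v) \<partial>K w)"
          using elim(1) by (intro suminf_cong) (rule spec)
        also have "\<dots> = (\<integral>\<^sup>+v. (\<Sum>i. indicator (A i) (w, v)) \<partial>K w)"
          by (rule nn_integral_suminf[symmetric]) (rule m)
        finally show ?case unfolding ind .
      qed
      have "(\<integral>\<^sup>+w. (\<Sum>i. h i w) \<partial>P) = (\<Sum>i. \<integral>\<^sup>+w. h i w \<partial>P)"
        by (rule nn_integral_suminf) measurable
      also have "\<dots> = (\<Sum>i. \<integral>\<^sup>+w. indicator (A i) (w, \<xi> w) \<partial>P)" unfolding h_int ..
      also have "\<dots> = (\<integral>\<^sup>+w. (\<Sum>i. indicator (A i) (w, \<xi> w)) \<partial>P)"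
        by (rule nn_integral_suminf[symmetric]) measurable
      finally show "(\<integral>\<^sup>+w. (\<Sum>i. h i w) \<partial>P) = (\<integral>\<^sup>+w. indicator (\<Union>i. A i) (w, \<xi> w) \<partial>P)"
        unfolding ind .
    qed measurable
  qed
qed

text \<open>Induction over nonnegative measurable functions, starting from the sets treated above.
  Each stage must again produce a measurable version of the kernel integral.\<close>

lemma cond_law_nn_integral:
  fixes \<xi> :: "'s \<Rightarrow> 'a::euclidean_space" and K :: "'s \<Rightarrow> 'a measure"
  assumes "prob_space P" and sub: "subalgebra P F" and \<xi>[measurable]: "\<xi> \<in> borel_measurable P"
    and K: "\<And>w. w \<in> space P \<Longrightarrow> prob_space (K w)" "\<And>w. w \<in> space P \<Longrightarrow> sets (K w) = sets borel"
    and law: "\<And>A. A \<in> sets borel \<Longrightarrow>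
      AE w in P. real_cond_exp P F (indicator {w \<in> space P. \<xi> w \<in> A}) w = measure (K w) A"
    and k: "k \<in> borel_measurable (F \<Otimes>\<^sub>M borel)"
  shows "\<exists>h\<in>borel_measurable F. (AE w in P. h w = (\<integral>\<^sup>+v. k (w, v) \<partial>K w)) \<and>
    (\<integral>\<^sup>+w. h w \<partial>P) = (\<integral>\<^sup>+w. k (w, \<xi> w) \<partial>P)"
proof -
  have space_F: "space F = space P" using sub unfolding subalgebra_def by simp
  have F_P: "h \<in> borel_measurable F \<Longrightarrow> h \<in> borel_measurable P" for h :: "'s \<Rightarrow> ennreal"
    using measurable_from_subalg[OF sub] .
  have id_F[measurable]: "(\<lambda>w. w) \<in> measurable P F"
    using sub unfolding subalgebra_def by (intro measurableI) (auto intro: subsetD sets.sets_into_space)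
  have meas_P: "(\<lambda>w. k (w, \<xi> w)) \<in> borel_measurable P" if [measurable]: "k \<in> borel_measurable (F \<Otimes>\<^sub>M borel)"
    for k :: "'s \<times> 'a \<Rightarrow> ennreal"
    by measurable
  have meas_K: "(\<lambda>v. k (w, v)) \<in> borel_measurable (K w)"
    if "w \<in> space P" and k: "k \<in> borel_measurable (F \<Otimes>\<^sub>M borel)" for w and k :: "'s \<times> 'a \<Rightarrow> ennreal"
  proof -
    have "w \<in> space F" using that space_F by simp
    then have "Pair w \<in> measurable (K w) (F \<Otimes>\<^sub>M borel)" using K(2)[OF that(1)] by (simp cong: measurable_cong_sets)
    from measurable_compose[OF this k] show ?thesis .
  qed
  show ?thesis using k
  proof (induction k)
    case (cong f g)
    have *: "f (w, v) = g (w, v)" if "w \<in> space P" for w v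
      using cong(3)[of "(w, v)"] that space_F by (simp add: space_pair_measure)
    from cong(4) obtain h where h: "h \<in> borel_measurable F"
      "AE w in P. h w = (\<integral>\<^sup>+v. g (w, v) \<partial>K w)" "(\<integral>\<^sup>+w. h w \<partial>P) = (\<integral>\<^sup>+w. g (w, \<xi> w) \<partial>P)" by blast
    have eq: "(\<integral>\<^sup>+v. f (w, v) \<partial>K w) = (\<integral>\<^sup>+v. g (w, v) \<partial>K w)" if "w \<in> space P" for w
      using *[OF that] by simp
    have "AE w in P. h w = (\<integral>\<^sup>+v. f (w, v) \<partial>K w)"
      using h(2) AE_space
    proof eventually_elim
      case (elim w)
      then show ?case using eq[of w] by argo
    qed
    moreover have "(\<integral>\<^sup>+w. f (w, \<xi> w) \<partial>P) = (\<integral>\<^sup>+w. g (w, \<xi> w) \<partial>P)"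
      by (rule nn_integral_cong) (rule *)
    ultimately show ?case using h(1,3) by metis
  next
    case (set A)
    then show ?case using cond_law_emeasure[OF assms(1-6)] by blast
  next
    case (mult u c)
    from mult(4) obtain h where [measurable]: "h \<in> borel_measurable F"
      and h: "AE w in P. h w = (\<integral>\<^sup>+v. u (w, v) \<partial>K w)" "(\<integral>\<^sup>+w. h w \<partial>P) = (\<integral>\<^sup>+w. u (w, \<xi> w) \<partial>P)" by blast
    show ?case
    proof (intro bexI[of _ "\<lambda>w. c * h w"] conjI)
      show "AE w in P. c * h w = (\<integral>\<^sup>+v. c * u (w, v) \<partial>K w)"
        using h(1) AE_space by eventually_elim (simp add: nn_integral_cmult meas_K mult)
      show "(\<integral>\<^sup>+w. c * h w \<partial>P) = (\<integral>\<^sup>+w. c * u (w, \<xi> w) \<partial>P)"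
        by (simp add: nn_integral_cmult meas_P mult h(2) F_P)
    qed measurable
  next
    case (add u v)
    from add obtain h where [measurable]: "h \<in> borel_measurable F"
      and h: "AE w in P. h w = (\<integral>\<^sup>+x. u (w, x) \<partial>K w)" "(\<integral>\<^sup>+w. h w \<partial>P) = (\<integral>\<^sup>+w. u (w, \<xi> w) \<partial>P)" by blast
    from add obtain h' where [measurable]: "h' \<in> borel_measurable F"
      and h': "AE w in P. h' w = (\<integral>\<^sup>+x. v (w, x) \<partial>K w)" "(\<integral>\<^sup>+w. h' w \<partial>P) = (\<integral>\<^sup>+w. v (w, \<xi> w) \<partial>P)" by blast
    show ?case
    proof (intro bexI[of _ "\<lambda>w. h' w + h w"] conjI)
      show "AE w in P. h' w + h w = (\<integral>\<^sup>+x. v (w, x) + u (w, x) \<partial>K w)"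
        using h(1) h'(1) AE_space by eventually_elim (simp add: nn_integral_add meas_K add)
      show "(\<integral>\<^sup>+w. h' w + h w \<partial>P) = (\<integral>\<^sup>+w. v (w, \<xi> w) + u (w, \<xi> w) \<partial>P)"
        by (simp add: nn_integral_add meas_P add h(2) h'(2) F_P)
    qed measurable
  next
    case (seq U)
    define R where "R i h \<longleftrightarrow> h \<in> borel_measurable F \<and> (AE w in P. h w = (\<integral>\<^sup>+v. U i (w, v) \<partial>K w)) \<and>
      (\<integral>\<^sup>+w. h w \<partial>P) = (\<integral>\<^sup>+w. U i (w, \<xi> w) \<partial>P)" for i h
    have "\<forall>i. \<exists>h. R i h" using seq.IH unfolding R_def Bex_def by (rule allI)
    from choice[OF this] obtain h where R: "\<forall>i. R i (h i)" ..
    have [measurable]: "\<And>i. h i \<in> borel_measurable F"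
      and h: "\<And>i. AE w in P. h i w = (\<integral>\<^sup>+v. U i (w, v) \<partial>K w)"
      and h_int: "\<And>i. (\<integral>\<^sup>+w. h i w \<partial>P) = (\<integral>\<^sup>+w. U i (w, \<xi> w) \<partial>P)"
      using R unfolding R_def by simp_all
    have [measurable]: "h i \<in> borel_measurable P" for i by (rule F_P) fact
    have inc: "incseq (\<lambda>i v. U i (w, v))" "incseq (\<lambda>i. U i (w, v))" for w v
      using seq(3) by (auto simp: incseq_def le_fun_def)
    have h': "AE w in P. \<forall>i. h i w = (\<integral>\<^sup>+v. U i (w, v) \<partial>K w)" using h by (simp add: AE_all_countable)
    have sup: "(SUP i. U i) y = (SUP i. U i y)" for y by (simp add: image_comp)
    show ?case
    proof (intro bexI[of _ "\<lambda>w. SUP i. h i w"] conjI)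
      show "AE w in P. (SUP i. h i w) = (\<integral>\<^sup>+v. (SUP i. U i) (w, v) \<partial>K w)"
        using h' AE_space
      proof eventually_elim
        case (elim w)
        then show ?case unfolding sup
          by (subst nn_integral_monotone_convergence_SUP[OF inc(1)]) (auto intro: meas_K seq(1))
      qed
      have "(\<integral>\<^sup>+w. (SUP i. h i w) \<partial>P) = (SUP i. \<integral>\<^sup>+w. h i w \<partial>P)"
      \<comment> \<open>The chosen versions agree with the increasing kernel integrals only off a
        null set, so monotone convergence is needed in its almost-everywhere form.\<close>
      proof (rule nn_integral_monotone_convergence_SUP_AE)
        show "AE w in P. h i w \<le> h (Suc i) w" for i
          using h' AE_space
        proof eventually_elim
          case (elim w)
          then show ?case by (simp add: nn_integral_mono incseq_SucD[OF inc(2)])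
        qed
      qed measurable
      also have "\<dots> = (SUP i. \<integral>\<^sup>+w. U i (w, \<xi> w) \<partial>P)" by (simp add: h_int)
      also have "\<dots> = (\<integral>\<^sup>+w. (SUP i. U i (w, \<xi> w)) \<partial>P)"
        using seq(3) by (intro nn_integral_monotone_convergence_SUP[symmetric] meas_P seq(1))
          (auto simp: incseq_def le_fun_def)
      finally show "(\<integral>\<^sup>+w. (SUP i. h i w) \<partial>P) = (\<integral>\<^sup>+w. (SUP i. U i) (w, \<xi> w) \<partial>P)" unfolding sup .
    qed measurable
  qed
qed

text \<open>The form in which the conditional law is applied: a bound on the kernel integral at each
  outcome passes to the expectation, and the auxiliary version \<open>h\<close> disappears.\<close>

lemma cond_law_nn_integral_le:
  fixes \<xi> :: "'s \<Rightarrow> 'a::euclidean_space" and K :: "'s \<Rightarrow> 'a measure"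
  assumes "prob_space P" "subalgebra P F" "\<xi> \<in> borel_measurable P"
    and "\<And>w. w \<in> space P \<Longrightarrow> prob_space (K w)" "\<And>w. w \<in> space P \<Longrightarrow> sets (K w) = sets borel"
    and "\<And>A. A \<in> sets borel \<Longrightarrow>
      AE w in P. real_cond_exp P F (indicator {w \<in> space P. \<xi> w \<in> A}) w = measure (K w) A"
    and "k \<in> borel_measurable (F \<Otimes>\<^sub>M borel)"
    and le: "\<And>w. w \<in> space P \<Longrightarrow> (\<integral>\<^sup>+v. k (w, v) \<partial>K w) \<le> b w"
  shows "(\<integral>\<^sup>+w. k (w, \<xi> w) \<partial>P) \<le> (\<integral>\<^sup>+w. b w \<partial>P)"
proof -
  obtain h where h: "AE w in P. h w = (\<integral>\<^sup>+v. k (w, v) \<partial>K w)" "(\<integral>\<^sup>+w. h w \<partial>P) = (\<integral>\<^sup>+w. k (w, \<xi> w) \<partial>P)"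
    using cond_law_nn_integral[OF assms(1-7)] by blast
  have "AE w in P. h w \<le> b w" using h(1) AE_space by eventually_elim (simp add: le)
  then show ?thesis unfolding h(2)[symmetric] by (rule nn_integral_mono_AE)
qed

section \<open>Tails of sums of adapted noise\<close>

text \<open>\<open>\<F> t\<close> is the information just before \<open>\<xi> t\<close> is drawn; in
  the method it includes the batch of iteration \<open>t\<close>, so that \<open>K t\<close> may
  depend on the selected branch. Measurability of earlier samples is stated for each later
  sigma-algebra directly, in place of monotonicity of the family.\<close>

locale adapted_oracle = prob_space P for P :: "'s measure" +
  fixes T :: nat and \<F> :: "nat \<Rightarrow> 's measure" and \<xi> :: "nat \<Rightarrow> 's \<Rightarrow> 'a::euclidean_space"
    and K :: "nat \<Rightarrow> 's \<Rightarrow> 'a measure"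
  assumes sub: "t < T \<Longrightarrow> subalgebra P (\<F> t)"
    and measurable_\<xi>: "t < T \<Longrightarrow> \<xi> t \<in> borel_measurable P"
    and adapted: "s < t \<Longrightarrow> t < T \<Longrightarrow> \<xi> s \<in> borel_measurable (\<F> t)"
    and K: "t < T \<Longrightarrow> w \<in> space P \<Longrightarrow> prob_space (K t w)"
      "t < T \<Longrightarrow> w \<in> space P \<Longrightarrow> sets (K t w) = sets borel"
    and law: "t < T \<Longrightarrow> A \<in> sets borel \<Longrightarrow>
      AE w in P. real_cond_exp P (\<F> t) (indicator {w \<in> space P. \<xi> t w \<in> A}) w = measure (K t w) A"
begin

text \<open>A supermartingale argument: the sum \<open>W\<close> of the earlier terms is measurable
  for \<open>\<F> n\<close>, hence a constant factor inside the kernel integral, and the last term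
  contributes at most \<open>exp (c n)\<close>.\<close>

lemma exp_sum_moment:
  fixes Y :: "nat \<Rightarrow> 's \<times> 'a \<Rightarrow> real"
  assumes Y: "\<And>s t. s \<le> t \<Longrightarrow> t < T \<Longrightarrow> Y s \<in> borel_measurable (\<F> t \<Otimes>\<^sub>M borel)"
    and moment: "\<And>t w. t < T \<Longrightarrow> w \<in> space P \<Longrightarrow>
      (\<integral>\<^sup>+v. ennreal (exp (Y t (w, v))) \<partial>K t w) \<le> ennreal (exp (c t))"
  shows "n \<le> T \<Longrightarrow> (\<integral>\<^sup>+w. ennreal (exp (\<Sum>t=m..<n. Y t (w, \<xi> t w))) \<partial>P) \<le> ennreal (exp (\<Sum>t=m..<n. c t))"
proof (induction n)
  case 0
  then show ?case by (simp add: emeasure_space_1)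
next
  case (Suc n)
  show ?case
  proof (cases "m \<le> n")
    case False
    then show ?thesis by (simp add: emeasure_space_1)
  next
    case True
    have n: "n < T" using Suc by simp
    define W where "W w = (\<Sum>t=m..<n. Y t (w, \<xi> t w))" for w
    have [measurable]: "W \<in> borel_measurable (\<F> n)"
      unfolding W_def
    proof (intro borel_measurable_sum)
      fix t assume "t \<in> {m..<n}"
      then have [measurable]: "\<xi> t \<in> borel_measurable (\<F> n)" "Y t \<in> borel_measurable (\<F> n \<Otimes>\<^sub>M borel)"
        using adapted Y n by auto
      show "(\<lambda>w. Y t (w, \<xi> t w)) \<in> borel_measurable (\<F> n)" by measurable
    qed
    have [measurable]: "Y n \<in> borel_measurable (\<F> n \<Otimes>\<^sub>M borel)" using Y n by auto
    have "(\<integral>\<^sup>+w. ennreal (exp (\<Sum>t=m..<Suc n. Y t (w, \<xi> t w))) \<partial>P) =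
        (\<integral>\<^sup>+w. (\<lambda>z. ennreal (exp (W (fst z))) * ennreal (exp (Y n z))) (w, \<xi> n w) \<partial>P)"
      using True by (intro nn_integral_cong) (simp add: W_def exp_add ennreal_mult)
    also have "\<dots> \<le> (\<integral>\<^sup>+w. ennreal (exp (W w)) * ennreal (exp (c n)) \<partial>P)"
    proof (rule cond_law_nn_integral_le[OF prob_space_axioms sub[OF n] measurable_\<xi>[OF n] K(1)[OF n] K(2)[OF n] law[OF n]])
      show "(\<lambda>z. ennreal (exp (W (fst z))) * ennreal (exp (Y n z))) \<in> borel_measurable (\<F> n \<Otimes>\<^sub>M borel)"
        by measurable
      fix w assume w: "w \<in> space P"
      have "space (\<F> n) = space P" using sub[OF n] unfolding subalgebra_def by simp
      then have "Pair w \<in> measurable (K n w) (\<F> n \<Otimes>\<^sub>M borel)"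
        using w K(2)[OF n w] by (simp cong: measurable_cong_sets)
      then have [measurable]: "(\<lambda>v. Y n (w, v)) \<in> borel_measurable (K n w)"
        by (rule measurable_compose) measurable
      have "(\<integral>\<^sup>+v. ennreal (exp (W w)) * ennreal (exp (Y n (w, v))) \<partial>K n w) =
          ennreal (exp (W w)) * (\<integral>\<^sup>+v. ennreal (exp (Y n (w, v))) \<partial>K n w)"
        by (rule nn_integral_cmult) measurable
      also have "\<dots> \<le> ennreal (exp (W w)) * ennreal (exp (c n))"
        using moment[OF n w] by (intro mult_left_mono) auto
      finally show "(\<integral>\<^sup>+v. ennreal (exp (W (fst (w, v)))) * ennreal (exp (Y n (w, v))) \<partial>K n w)
          \<le> ennreal (exp (W w)) * ennreal (exp (c n))" by simp
    qed auto
    also have "\<dots> = (\<integral>\<^sup>+w. ennreal (exp (W w)) \<partial>P) * ennreal (exp (c n))"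
      using measurable_from_subalg[OF sub[OF n] \<open>W \<in> _\<close>] by (intro nn_integral_multc) auto
    also have "\<dots> \<le> ennreal (exp (\<Sum>t=m..<n. c t)) * ennreal (exp (c n))"
      using Suc unfolding W_def by (intro mult_right_mono) auto
    also have "\<dots> = ennreal (exp (\<Sum>t=m..<Suc n. c t))"
      using True by (simp add: ennreal_mult exp_add)
    finally show ?thesis .
  qed
qed

text \<open>Chernoff's bound with exponent 1; any scaling that should be optimised is built into
  \<open>Y\<close>.\<close>

lemma sum_tail:
  fixes Y :: "nat \<Rightarrow> 's \<times> 'a \<Rightarrow> real"
  assumes Y: "\<And>s t. s \<le> t \<Longrightarrow> t < T \<Longrightarrow> Y s \<in> borel_measurable (\<F> t \<Otimes>\<^sub>M borel)"
    and moment: "\<And>t w. t < T \<Longrightarrow> w \<in> space P \<Longrightarrow>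
      (\<integral>\<^sup>+v. ennreal (exp (Y t (w, v))) \<partial>K t w) \<le> ennreal (exp (c t))"
  shows "(\<lambda>w. \<Sum>t=m..<T. Y t (w, \<xi> t w)) \<in> borel_measurable P"
    and "prob {w \<in> space P. (\<Sum>t=m..<T. Y t (w, \<xi> t w)) \<ge> (\<Sum>t=m..<T. c t) + L} \<le> exp (- L)"
proof -
  show meas[measurable]: "(\<lambda>w. \<Sum>t=m..<T. Y t (w, \<xi> t w)) \<in> borel_measurable P"
  proof (intro borel_measurable_sum)
    fix t assume "t \<in> {m..<T}"
    then have t: "t < T" by simp
    have [measurable]: "\<xi> t \<in> borel_measurable P" "Y t \<in> borel_measurable (\<F> t \<Otimes>\<^sub>M borel)"
      using measurable_\<xi> Y t by auto
    have [measurable]: "(\<lambda>w. w) \<in> measurable P (\<F> t)"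
      using sub[OF t] unfolding subalgebra_def
      by (intro measurableI) (auto intro: subsetD sets.sets_into_space)
    show "(\<lambda>w. Y t (w, \<xi> t w)) \<in> borel_measurable P" by measurable
  qed
  let ?C = "\<Sum>t=m..<T. c t" and ?Y = "\<lambda>w. \<Sum>t=m..<T. Y t (w, \<xi> t w)"
  have "emeasure P {w \<in> space P. ?Y w \<ge> ?C + L} \<le>
      ennreal (exp (- 1 * (?C + L))) * (\<integral>\<^sup>+w. ennreal (exp (1 * ?Y w)) * indicator (space P) w \<partial>P)"
    by (rule Chernoff_ineq_nn_integral_ge) auto
  also have "\<dots> = ennreal (exp (- (?C + L))) * (\<integral>\<^sup>+w. ennreal (exp (?Y w)) \<partial>P)"
    by (intro arg_cong2[where f = "(*)"] nn_integral_cong) auto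
  also have "\<dots> \<le> ennreal (exp (- (?C + L))) * ennreal (exp ?C)"
    by (intro mult_left_mono exp_sum_moment[OF Y moment]) auto
  also have "\<dots> = ennreal (exp (- L))" by (simp add: ennreal_mult[symmetric] exp_add[symmetric])
  finally show "prob {w \<in> space P. ?Y w \<ge> ?C + L} \<le> exp (- L)"
    unfolding emeasure_eq_measure by (simp add: ennreal_le_iff)
qed

end

section \<open>The switching method\<close>

lemma expectation_output_index:
  fixes h :: "nat \<Rightarrow> real"
  assumes "finite I" "I \<noteq> {}" "\<And>t. t \<in> I \<Longrightarrow> \<eta> t > 0"
  shows "measure_pmf.expectation (output_index \<eta> I) h = (\<Sum>t\<in>I. \<eta> t * h t) / (\<Sum>t\<in>I. \<eta> t)"
proof -
  let ?p = "\<lambda>t. if t \<in> I then \<eta> t / (\<Sum>s\<in>I. \<eta> s) else 0"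
  have pos: "(\<Sum>s\<in>I. \<eta> s) > 0" using assms by (intro sum_pos) auto
  have nonneg: "0 \<le> ?p t" for t using assms(3)[of t] pos by (auto intro: less_imp_le)
  have "(\<integral>\<^sup>+t. ennreal (?p t) \<partial>count_space UNIV) = (\<integral>\<^sup>+t. ennreal (?p t) \<partial>count_space I)"
    by (subst nn_integral_count_space_indicator) (auto intro!: nn_integral_cong split: split_indicator)
  also have "\<dots> = (\<Sum>t\<in>I. ennreal (?p t))" by (rule nn_integral_count_space_finite[OF assms(1)])
  also have "\<dots> = ennreal (\<Sum>t\<in>I. ?p t)" by (rule sum_ennreal) (rule nonneg)
  also have "(\<Sum>t\<in>I. ?p t) = 1" using pos by (simp add: sum_divide_distrib[symmetric])
  finally have pmf: "pmf (output_index \<eta> I) t = ?p t" for t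
    unfolding output_index_def by (intro pmf_embed_pmf nonneg) simp
  have "measure_pmf.expectation (output_index \<eta> I) h = (\<Sum>t\<in>I. h t * pmf (output_index \<eta> I) t)"
    using assms(1) by (intro integral_measure_pmf_real) (auto simp: set_pmf_iff pmf split: if_splits)
  also have "\<dots> = (\<Sum>t\<in>I. \<eta> t * h t) / (\<Sum>t\<in>I. \<eta> t)"
    unfolding pmf sum_divide_distrib by (intro sum.cong) (auto simp: mult.commute)
  finally show ?thesis .
qed

text \<open>\<open>G\<close> is known to be continuous only on \<open>X\<close>, so measurability
  along the iterates passes through the Borel sets of \<open>X\<close>.\<close>

lemma measurable_continuous_compose:
  assumes "continuous_on X h" "x \<in> borel_measurable N" "\<And>w. w \<in> space N \<Longrightarrow> x w \<in> X"
  shows "(\<lambda>w. h (x w)) \<in> borel_measurable N"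
proof -
  have "x \<in> measurable N (restrict_space borel X)"
    using assms by (intro measurable_restrict_space2) auto
  from measurable_compose[OF this borel_measurable_continuous_on_restrict[OF assms(1)]]
  show ?thesis .
qed

context constrained_problem
begin

text \<open>With tolerance \<open>b\<close>, an upper bound for the mean of
  \<open>v \<bullet> (prox x - x)\<close> in the branch that \<open>G x\<close> selects; deviations
  are measured from it instead of from the unknown mean.\<close>

definition drift_bound :: "real \<Rightarrow> 'a \<Rightarrow> real" where
  "drift_bound b x = (if G x \<le> b then multiplier_bound * b - (\<rho>h - \<rho>) * (norm (prox x - x))\<^sup>2 else - b)"

lemma iterate_in: "x0 \<in> X \<Longrightarrow> iterate X \<eta> x0 \<xi> t w \<in> X"
  by (cases t) (auto intro!: closest_point_in_set closed_X)

lemma measurable_iterate: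
  assumes "x0 \<in> X" "\<And>s. s < t \<Longrightarrow> \<xi> s \<in> borel_measurable N"
  shows "iterate X \<eta> x0 \<xi> t \<in> borel_measurable N"
  using assms(2)
proof (induction t)
  case 0
  have "iterate X \<eta> x0 \<xi> 0 = (\<lambda>w. x0)" by auto
  then show ?case by simp
next
  case (Suc t)
  have "X \<noteq> {}" using assms(1) by auto
  then have [measurable]: "closest_point X \<in> borel_measurable borel"
    using continuous_on_closest_point[OF convex_X closed_X] by (intro borel_measurable_continuous_onI)
  have [measurable]: "iterate X \<eta> x0 \<xi> t \<in> borel_measurable N" "\<xi> t \<in> borel_measurable N"
    using Suc by auto
  have "iterate X \<eta> x0 \<xi> (Suc t) = (\<lambda>w. closest_point X (iterate X \<eta> x0 \<xi> t w - \<eta> t *\<^sub>R \<xi> t w))" by auto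
  then show ?case by simp
qed

text \<open>Replacing \<open>drift_bound\<close> by the true mean, which it dominates, only raises
  the exponent. What is left is centred, in the direction \<open>s *\<^sub>R (prox x - x)\<close> of
  length at most \<open>s * D\<close>.\<close>

lemma drift_moment:
  assumes x: "x \<in> X" and b: "0 \<le> b" and s: "0 \<le> s"
    and Qf: "subgradient_oracle X f M Qf" and Qg: "subgradient_oracle X g M Qg"
    and Q: "Q = (if G x \<le> b then Qf x else Qg x)"
  shows "(\<integral>\<^sup>+v. ennreal (exp (s * (v \<bullet> (prox x - x) - drift_bound b x))) \<partial>Q) \<le> ennreal (exp (4 * M\<^sup>2 * (s\<^sup>2 * D\<^sup>2)))"
proof -
  let ?m = "\<integral>v. v \<partial>Q" and ?q = "s *\<^sub>R (prox x - x)"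
  have Q': "prob_space Q" "sets Q = sets borel" "integrable Q (\<lambda>v. v)"
      "(\<integral>\<^sup>+v. ennreal (exp ((norm v)\<^sup>2 / M\<^sup>2)) \<partial>Q) \<le> ennreal (exp 1)"
    and m: "?m \<in> (if G x \<le> b then frechet_subdiff f x else frechet_subdiff g x)"
    using Qf Qg x unfolding Q subgradient_oracle_def by auto
  have "norm ?m \<le> M" using m f_bound[OF x] g_bound[OF x] by (auto split: if_splits)
  have "?m \<bullet> (prox x - x) \<le> drift_bound b x"
  proof (cases "G x \<le> b")
    case True
    have "multiplier_bound * max (G x) 0 \<le> multiplier_bound * b"
      using True b multiplier_bound_pos by (intro mult_left_mono) auto
    then show ?thesis using True m f_subgradient_towards_prox[OF x, of ?m] unfolding drift_bound_def by simp
  next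
    case False
    then show ?thesis using m g_subgradient_towards_prox[OF x, of ?m] unfolding drift_bound_def by simp
  qed
  then have "s * (?m \<bullet> (prox x - x)) \<le> s * drift_bound b x" using s by (rule mult_left_mono)
  then have "(\<integral>\<^sup>+v. ennreal (exp (s * (v \<bullet> (prox x - x) - drift_bound b x))) \<partial>Q)
      \<le> (\<integral>\<^sup>+v. ennreal (exp ((v - ?m) \<bullet> ?q)) \<partial>Q)"
    by (intro nn_integral_mono ennreal_leI) (simp add: inner_diff_left right_diff_distrib)
  also have "\<dots> \<le> ennreal (exp (4 * M\<^sup>2 * (norm ?q)\<^sup>2))"
    using Q' M_pos \<open>norm ?m \<le> M\<close> by (intro centred_inner_mgf_bound) auto
  also have "\<dots> \<le> ennreal (exp (4 * M\<^sup>2 * (s\<^sup>2 * D\<^sup>2)))"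
  proof (intro ennreal_leI)
    have "(norm ?q)\<^sup>2 \<le> (s * D)\<^sup>2"
      using s diameter[OF prox_in x] by (intro power_mono) (auto intro: mult_left_mono)
    then have "4 * M\<^sup>2 * (norm ?q)\<^sup>2 \<le> 4 * M\<^sup>2 * (s\<^sup>2 * D\<^sup>2)"
      by (intro mult_left_mono) (auto simp: power_mult_distrib)
    then show "exp (4 * M\<^sup>2 * (norm ?q)\<^sup>2) \<le> exp (4 * M\<^sup>2 * (s\<^sup>2 * D\<^sup>2))" by simp
  qed
  finally show ?thesis .
qed

lemma envelope_sum:
  assumes x: "\<And>t. x t \<in> X" "\<And>t. x (Suc t) = closest_point X (x t - \<eta> t *\<^sub>R v t)" and "S \<le> T"
  shows "envelope (x T) \<le> envelope (x S) + \<rho>h *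
    (\<Sum>t=S..<T. \<eta> t * (v t \<bullet> (prox (x t) - x t)) + (\<eta> t)\<^sup>2 * (norm (v t))\<^sup>2 / 2)"
  using \<open>S \<le> T\<close>
proof (induction T rule: dec_induct)
  case (step n)
  then show ?case
    using envelope_step[OF x(1)[of n], of "\<eta> n" "v n"] unfolding x(2)[of n] by (simp add: distrib_left)
qed simp

text \<open>
  If the noise is so small that the decrease of the envelope over all steps
  cannot pay for \<open>\<Sum>\<eta> t * b t\<close>, then objective steps occur, and close to their proximal points.
\<close>

lemma objective_steps_average:
  fixes x v :: "nat \<Rightarrow> 'a" and \<eta> b :: "nat \<Rightarrow> real" and S T :: nat
  defines "I \<equiv> {t \<in> {S..<T}. G (x t) \<le> b t}"
  assumes x: "\<And>t. x t \<in> X" "\<And>t. x (Suc t) = closest_point X (x t - \<eta> t *\<^sub>R v t)" and "S \<le> T"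
    and \<eta>: "\<And>t. t \<in> {S..<T} \<Longrightarrow> \<eta> t > 0" and b: "\<And>t. t \<in> {S..<T} \<Longrightarrow> b t \<le> c"
    and c: "(1 + multiplier_bound) * c = \<epsilon>\<^sup>2 * (\<rho>h - \<rho>)" and \<epsilon>: "\<epsilon> > 0"
    and size: "(\<Sum>t=S..<T. (\<eta> t)\<^sup>2 * (norm (v t))\<^sup>2) < N1"
    and drift: "(\<Sum>t=S..<T. \<eta> t * (v t \<bullet> (prox (x t) - x t) - drift_bound (b t) (x t))) < N2"
    and budget: "D\<^sup>2 / 2 + N1 / 2 + N2 \<le> (\<Sum>t=S..<T. \<eta> t * b t)"
  shows "I \<noteq> {}"
    and "(\<Sum>t\<in>I. \<eta> t * norm (prox (x t) - x t)) \<le> \<epsilon> * (\<Sum>t\<in>I. \<eta> t)"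
    and "(\<Sum>t\<in>I. \<eta> t * G (x t)) \<le> c * (\<Sum>t\<in>I. \<eta> t)"
proof -
  let ?\<mu> = "\<rho>h - \<rho>" and ?d = "\<lambda>t. norm (prox (x t) - x t)"
  have "envelope (x S) \<le> envelope (x S) + \<rho>h * (D\<^sup>2 / 2 +
      (\<Sum>t=S..<T. \<eta> t * (v t \<bullet> (prox (x t) - x t)) + (\<eta> t)\<^sup>2 * (norm (v t))\<^sup>2 / 2))"
    using envelope_sum[where x = x and \<eta> = \<eta> and v = v, OF x \<open>S \<le> T\<close>] envelope_oscillation[OF x(1), of S "x T"] by (simp add: distrib_left)
  then have "0 \<le> \<rho>h * (D\<^sup>2 / 2 +
      (\<Sum>t=S..<T. \<eta> t * (v t \<bullet> (prox (x t) - x t)) + (\<eta> t)\<^sup>2 * (norm (v t))\<^sup>2 / 2))" by simp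
  moreover have "\<rho>h > 0" using \<rho>_nonneg \<rho>h_gt by simp
  ultimately have "0 \<le> D\<^sup>2 / 2 + (\<Sum>t=S..<T. \<eta> t * (v t \<bullet> (prox (x t) - x t)) + (\<eta> t)\<^sup>2 * (norm (v t))\<^sup>2 / 2)"
    by (simp add: zero_le_mult_iff)
  \<comment> \<open>The sum splits into deviation, squared sizes and mean bound; only the last
    depends on the branches.\<close>
  also have "\<dots> = D\<^sup>2 / 2 + (\<Sum>t=S..<T. \<eta> t * (v t \<bullet> (prox (x t) - x t) - drift_bound (b t) (x t)))
      + (\<Sum>t=S..<T. (\<eta> t)\<^sup>2 * (norm (v t))\<^sup>2) / 2 + (\<Sum>t=S..<T. \<eta> t * drift_bound (b t) (x t))"
    by (simp add: sum.distrib[symmetric] sum_divide_distrib algebra_simps)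
  also have "\<dots> < (\<Sum>t=S..<T. \<eta> t * b t) + (\<Sum>t=S..<T. \<eta> t * drift_bound (b t) (x t))"
    using size drift budget by linarith
  also have "\<dots> = (\<Sum>t=S..<T. \<eta> t * (b t + drift_bound (b t) (x t)))"
    by (simp add: sum.distrib[symmetric] distrib_left)
  \<comment> \<open>On a constraint step \<open>drift_bound\<close> is \<open>- b t\<close> and the
    summand is 0. On an objective step the tolerance is paid \<open>1 + multiplier_bound\<close>
    times, which is at most \<open>(\<rho>h - \<rho>)\<close> times the square of
    \<open>\<epsilon>\<close> by the choice of \<open>c\<close>.\<close>
  also have "\<dots> \<le> (\<Sum>t=S..<T. if t \<in> I then \<eta> t * (?\<mu> * (\<epsilon>\<^sup>2 - (?d t)\<^sup>2)) else 0)"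
  proof (intro sum_mono)
    fix t assume t: "t \<in> {S..<T}"
    show "\<eta> t * (b t + drift_bound (b t) (x t)) \<le> (if t \<in> I then \<eta> t * (?\<mu> * (\<epsilon>\<^sup>2 - (?d t)\<^sup>2)) else 0)"
    proof (cases "t \<in> I")
      case True
      have "(1 + multiplier_bound) * b t \<le> (1 + multiplier_bound) * c"
        using b[OF t] multiplier_bound_pos by (intro mult_left_mono) auto
      then have "b t + drift_bound (b t) (x t) \<le> ?\<mu> * (\<epsilon>\<^sup>2 - (?d t)\<^sup>2)"
        using True unfolding c I_def drift_bound_def by (simp add: algebra_simps)
      then show ?thesis using True \<eta>[OF t] by simp
    next
      case False
      then show ?thesis using t unfolding I_def drift_bound_def by simp
    qed
  qed
  also have "\<dots> = (\<Sum>t\<in>I. \<eta> t * (?\<mu> * (\<epsilon>\<^sup>2 - (?d t)\<^sup>2)))"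
    unfolding I_def by (subst sum.inter_filter) (auto intro!: sum.cong)
  also have "\<dots> = ?\<mu> * (\<Sum>t\<in>I. \<eta> t * (\<epsilon>\<^sup>2 - (?d t)\<^sup>2))"
    by (simp add: sum_distrib_left mult.left_commute)
  finally have *: "0 < (\<Sum>t\<in>I. \<eta> t * (\<epsilon>\<^sup>2 - (?d t)\<^sup>2))"
    using \<rho>h_gt by (simp add: zero_less_mult_iff)
  \<comment> \<open>The strict noise bounds made the sum positive, whereas an empty sum is
    0.\<close>
  then show "I \<noteq> {}" by auto
  have \<eta>I: "\<eta> t > 0" if "t \<in> I" for t using that \<eta> unfolding I_def by auto
  have "0 \<le> (\<Sum>t\<in>I. \<eta> t * (\<epsilon>\<^sup>2 - (?d t)\<^sup>2))" using * by simp
  \<comment> \<open>The tangent of the square at \<open>\<epsilon>\<close> passes from squared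
    distances to distances termwise, in place of Jensen's inequality.\<close>
  also have "\<dots> \<le> (\<Sum>t\<in>I. \<eta> t * (2 * \<epsilon> * (\<epsilon> - ?d t)))"
  proof (intro sum_mono mult_left_mono)
    fix t
    have "0 \<le> (\<epsilon> - ?d t)\<^sup>2" by simp
    then show "\<epsilon>\<^sup>2 - (?d t)\<^sup>2 \<le> 2 * \<epsilon> * (\<epsilon> - ?d t)"
      by (simp add: power2_eq_square algebra_simps)
  qed (auto intro: less_imp_le \<eta>I)
  also have "\<dots> = 2 * \<epsilon> * (\<epsilon> * (\<Sum>t\<in>I. \<eta> t) - (\<Sum>t\<in>I. \<eta> t * ?d t))"
    by (simp add: sum_distrib_left sum_subtractf[symmetric] algebra_simps)
  finally show "(\<Sum>t\<in>I. \<eta> t * ?d t) \<le> \<epsilon> * (\<Sum>t\<in>I. \<eta> t)" using \<epsilon> by (simp add: zero_le_mult_iff)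
  show "(\<Sum>t\<in>I. \<eta> t * G (x t)) \<le> c * (\<Sum>t\<in>I. \<eta> t)"
    unfolding sum_distrib_left
  proof (intro sum_mono)
    fix t assume t: "t \<in> I"
    then have "G (x t) \<le> c" using b[of t] unfolding I_def by auto
    then show "\<eta> t * G (x t) \<le> c * \<eta> t" using \<eta>I[OF t] by (simp add: mult.commute)
  qed
qed

end

section \<open>From oracle noise to a bound on the failure probability\<close>

lemma subalgebra_history:
  assumes "\<And>t i. t < m \<Longrightarrow> i < B \<Longrightarrow> \<omega> t i \<in> borel_measurable P"
    and "\<And>t. t < n \<Longrightarrow> \<xi> t \<in> borel_measurable P"
  shows "subalgebra P (history P B \<omega> \<xi> m n)"
    and "t < n \<Longrightarrow> \<xi> t \<in> borel_measurable (history P B \<omega> \<xi> m n)"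
proof -
  let ?G = "{\<omega> t i -` A \<inter> space P | t i A. t < m \<and> i < B \<and> A \<in> sets borel} \<union>
      {\<xi> t -` A \<inter> space P | t A. t < n \<and> A \<in> sets borel}"
  have G: "?G \<subseteq> Pow (space P)" by auto
  have "?G \<subseteq> sets P" using assms by (auto intro: measurable_sets)
  then show "subalgebra P (history P B \<omega> \<xi> m n)"
    unfolding subalgebra_def history_def
    by (simp add: space_measure_of[OF G] sets_measure_of[OF G] sets.sigma_sets_subset)
  show "\<xi> t \<in> borel_measurable (history P B \<omega> \<xi> m n)" if "t < n"
    unfolding history_def
  proof (rule measurableI)
    fix A :: "'b set" assume "A \<in> sets borel"
    then have "\<xi> t -` A \<inter> space P \<in> ?G" using that by blast
    then show "\<xi> t -` A \<inter> space (sigma (space P) ?G) \<in> sets (sigma (space P) ?G)"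
      by (simp add: space_measure_of[OF G] sets_measure_of[OF G] sigma_sets.Basic)
  qed simp
qed

text \<open>Common to both step-size rules, which differ only in how they meet
  \<open>budget\<close>. Means over the output index are kept as sums multiplied by the total
  weight, and \<open>L\<close> is the logarithmic confidence granted to each of the two noise
  sums.\<close>

lemma (in constrained_problem) switching_method_probability:
  fixes Q\<^sub>f Q\<^sub>g :: "'a \<Rightarrow> 'a measure" and P :: "'s measure" and S T :: nat and \<eta> b :: "nat \<Rightarrow> real"
    and \<xi> :: "nat \<Rightarrow> 's \<Rightarrow> 'a" and x0 :: 'a
  defines "x \<equiv> iterate X \<eta> x0 \<xi>"
  defines "I \<equiv> \<lambda>w. {t \<in> {S..<T}. G (x t w) \<le> b t}"
  assumes samples: "adapted_oracle P T \<F> \<xi> (\<lambda>t w. if G (x t w) \<le> b t then Q\<^sub>f (x t w) else Q\<^sub>g (x t w))"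
    and x0: "x0 \<in> X" and Qf: "subgradient_oracle X f M Q\<^sub>f" and Qg: "subgradient_oracle X g M Q\<^sub>g"
    and ST: "S < T" and \<eta>: "\<And>t. t < T \<Longrightarrow> 0 < \<eta> t" "\<And>t. S \<le> t \<Longrightarrow> t < T \<Longrightarrow> \<eta> t \<le> \<eta>m"
    and b: "\<And>t. t < T \<Longrightarrow> 0 \<le> b t" "\<And>t. S \<le> t \<Longrightarrow> t < T \<Longrightarrow> b t \<le> c"
    and c: "(1 + multiplier_bound) * c = \<epsilon>\<^sup>2 * (\<rho>h - \<rho>)" and \<epsilon>: "\<epsilon> > 0" and L: "L > 0"
    and budget: "D\<^sup>2 / 2 + M\<^sup>2 * ((\<Sum>t=S..<T. (\<eta> t)\<^sup>2) + \<eta>m\<^sup>2 * L) / 2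
      + 4 * M * D * sqrt (L * (\<Sum>t=S..<T. (\<eta> t)\<^sup>2)) \<le> (\<Sum>t=S..<T. \<eta> t * b t)"
  shows "measure P {w \<in> space P. I w \<noteq> {} \<and>
      (\<Sum>t\<in>I w. \<eta> t * norm (prox (x t w) - x t w)) \<le> \<epsilon> * (\<Sum>t\<in>I w. \<eta> t) \<and>
      (\<Sum>t\<in>I w. \<eta> t * G (x t w)) \<le> c * (\<Sum>t\<in>I w. \<eta> t)} \<ge> 1 - 2 * exp (- L)"
proof -
  interpret adapted_oracle P T \<F> \<xi> "\<lambda>t w. if G (x t w) \<le> b t then Q\<^sub>f (x t w) else Q\<^sub>g (x t w)"
    by (rule samples)
  have x_in: "x t w \<in> X" for t w unfolding x_def using x0 by (rule iterate_in)
  have x_meas: "x s \<in> borel_measurable (\<F> t)" if "s \<le> t" "t < T" for s t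
    unfolding x_def using that adapted by (intro measurable_iterate x0) auto
  have x_meas_P: "x t \<in> borel_measurable P" if "t < T" for t
    using measurable_from_subalg[OF sub x_meas] that by auto
  let ?V = "\<Sum>t=S..<T. (\<eta> t)\<^sup>2"
  have V: "?V > 0" using ST by (intro sum_pos zero_less_power) (auto intro: \<eta>(1))
  have \<eta>m: "\<eta>m > 0" using \<eta>(1)[of S] \<eta>(2)[of S] ST by auto

  \<comment> \<open>Dividing by \<open>\<eta>m\<close> makes the coefficient of the light-tailed
    variable at most 1, as \<open>exp_moment_power\<close> requires. Before \<open>S\<close>, where
    \<open>\<eta>m\<close> need not bound the steps, the term is set to 0 because the moment
    condition is demanded for every \<open>t < T\<close>.\<close>
  define Y1 where "Y1 t = (\<lambda>z::'s \<times> 'a. if S \<le> t then (\<eta> t)\<^sup>2 / \<eta>m\<^sup>2 * ((norm (snd z))\<^sup>2 / M\<^sup>2) else 0)" for t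
  define c1 where "c1 t = (if S \<le> t then (\<eta> t)\<^sup>2 / \<eta>m\<^sup>2 else 0)" for t
  have Y1_meas: "Y1 s \<in> borel_measurable (\<F> t \<Otimes>\<^sub>M borel)" for s t unfolding Y1_def by measurable
  have Y1_moment: "(\<integral>\<^sup>+v. ennreal (exp (Y1 t (w, v))) \<partial>(if G (x t w) \<le> b t then Q\<^sub>f (x t w) else Q\<^sub>g (x t w))) \<le> ennreal (exp (c1 t))"
    if t: "t < T" and w: "w \<in> space P" for t w
  proof -
    let ?Q = "if G (x t w) \<le> b t then Q\<^sub>f (x t w) else Q\<^sub>g (x t w)"
    have Q: "prob_space ?Q" "sets ?Q = sets borel"
      "(\<integral>\<^sup>+v. ennreal (exp ((norm v)\<^sup>2 / M\<^sup>2)) \<partial>?Q) \<le> ennreal (exp 1)"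
      using Qf Qg x_in unfolding subgradient_oracle_def by auto
    have [measurable]: "(\<lambda>v. (norm v)\<^sup>2 / M\<^sup>2) \<in> borel_measurable ?Q"
      unfolding measurable_cong_sets[OF Q(2) refl] by measurable
    have "0 \<le> c1 t" "c1 t \<le> 1"
      using \<eta>(1)[OF t] \<eta>(2)[OF _ t] \<eta>m unfolding c1_def by (auto intro!: power_mono)
    from exp_moment_power[OF Q(1) _ Q(3) this] show ?thesis
      unfolding Y1_def c1_def by (cases "S \<le> t") simp_all
  qed
  define E1 where "E1 = {w \<in> space P. (\<Sum>t=S..<T. Y1 t (w, \<xi> t w)) \<ge> (\<Sum>t=S..<T. c1 t) + L}"
  have E1: "prob E1 \<le> exp (- L)" unfolding E1_def by (rule sum_tail(2)[OF Y1_meas Y1_moment])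
  have E1_sets: "E1 \<in> sets P"
    unfolding E1_def using sum_tail(1)[OF Y1_meas Y1_moment] by measurable

  \<comment> \<open>The minimiser of
    \<open>(4 * M^2 * D^2 * ?V * \<theta>^2 + L) / \<theta>\<close>, the deviation that Chernoff's
    bound allows. At this point both summands of the numerator equal \<open>L\<close>, whence the
    threshold \<open>2 * L\<close> below.\<close>
  define \<theta> where "\<theta> = sqrt (L / ?V) / (2 * M * D)"
  have \<theta>: "\<theta> > 0" unfolding \<theta>_def using L V M_pos D_pos by simp
  have \<theta>2: "4 * M\<^sup>2 * (\<theta>\<^sup>2 * D\<^sup>2) * ?V = L"
    unfolding \<theta>_def using L V M_pos D_pos by (simp add: power_divide power_mult_distrib field_simps)
  have \<theta>L: "2 * L = \<theta> * (4 * M * D * sqrt (L * ?V))"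
  proof -
    have "\<theta> * (4 * M * D * sqrt (L * ?V)) = 2 * (sqrt (L / ?V) * sqrt (L * ?V))"
      unfolding \<theta>_def using M_pos D_pos by simp
    also have "sqrt (L / ?V) * sqrt (L * ?V) = sqrt (L\<^sup>2)"
      unfolding real_sqrt_mult[symmetric] using V by (simp add: power2_eq_square)
    finally show ?thesis using L by simp
  qed
  define Y2 where "Y2 t = (\<lambda>z. \<theta> * \<eta> t * (snd z \<bullet> (prox (x t (fst z)) - x t (fst z)) - drift_bound (b t) (x t (fst z))))" for t
  have Y2_meas: "Y2 s \<in> borel_measurable (\<F> t \<Otimes>\<^sub>M borel)" if "s \<le> t" "t < T" for s t
  proof -
    have [measurable]: "x s \<in> borel_measurable (\<F> t)" by (rule x_meas[OF that])
    have [measurable]: "(\<lambda>w. prox (x s w)) \<in> borel_measurable (\<F> t)" "(\<lambda>w. G (x s w)) \<in> borel_measurable (\<F> t)"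
      using x_in by (auto intro!: measurable_continuous_compose[OF continuous_prox[of X]]
        measurable_continuous_compose[OF continuous_G])
    show ?thesis unfolding Y2_def drift_bound_def by measurable
  qed
  have Y2_moment: "(\<integral>\<^sup>+v. ennreal (exp (Y2 t (w, v))) \<partial>(if G (x t w) \<le> b t then Q\<^sub>f (x t w) else Q\<^sub>g (x t w)))
      \<le> ennreal (exp (4 * M\<^sup>2 * ((\<theta> * \<eta> t)\<^sup>2 * D\<^sup>2)))" if "t < T" "w \<in> space P" for t w
    unfolding Y2_def fst_conv snd_conv
    using that \<theta> \<eta>(1)[of t] b(1)[of t] by (intro drift_moment[OF x_in _ _ Qf Qg refl]) auto
  have c2: "(\<Sum>t=S..<T. 4 * M\<^sup>2 * ((\<theta> * \<eta> t)\<^sup>2 * D\<^sup>2)) = L"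
    unfolding \<theta>2[symmetric] sum_distrib_left by (simp add: power_mult_distrib mult_ac)
  define E2 where "E2 = {w \<in> space P. (\<Sum>t=S..<T. Y2 t (w, \<xi> t w)) \<ge> (\<Sum>t=S..<T. 4 * M\<^sup>2 * ((\<theta> * \<eta> t)\<^sup>2 * D\<^sup>2)) + L}"
  have E2: "prob E2 \<le> exp (- L)" unfolding E2_def by (rule sum_tail(2)[OF Y2_meas Y2_moment])
  have E2_sets: "E2 \<in> sets P"
    unfolding E2_def using sum_tail(1)[OF Y2_meas Y2_moment] by measurable

  let ?E = "{w \<in> space P. I w \<noteq> {} \<and>
      (\<Sum>t\<in>I w. \<eta> t * norm (prox (x t w) - x t w)) \<le> \<epsilon> * (\<Sum>t\<in>I w. \<eta> t) \<and>
      (\<Sum>t\<in>I w. \<eta> t * G (x t w)) \<le> c * (\<Sum>t\<in>I w. \<eta> t)}"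
  \<comment> \<open>Off the two exceptional events the argument is deterministic, path by
    path.\<close>
  have sub: "space P - (E1 \<union> E2) \<subseteq> ?E"
  proof
    fix w assume "w \<in> space P - (E1 \<union> E2)"
    then have w: "w \<in> space P" and 1: "(\<Sum>t=S..<T. Y1 t (w, \<xi> t w)) < (\<Sum>t=S..<T. c1 t) + L"
      and 2: "(\<Sum>t=S..<T. Y2 t (w, \<xi> t w)) < 2 * L"
      unfolding E1_def E2_def c2 by auto
    have "(\<Sum>t=S..<T. (\<eta> t)\<^sup>2 * (norm (\<xi> t w))\<^sup>2) = M\<^sup>2 * \<eta>m\<^sup>2 * (\<Sum>t=S..<T. Y1 t (w, \<xi> t w))"
      unfolding sum_distrib_left Y1_def using M_pos \<eta>m by (intro sum.cong) auto
    also have "\<dots> < M\<^sup>2 * \<eta>m\<^sup>2 * ((\<Sum>t=S..<T. c1 t) + L)"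
      using 1 M_pos \<eta>m by (intro mult_strict_left_mono) auto
    also have "(\<Sum>t=S..<T. c1 t) = ?V / \<eta>m\<^sup>2"
      unfolding c1_def sum_divide_distrib by (intro sum.cong) auto
    also have "M\<^sup>2 * \<eta>m\<^sup>2 * (?V / \<eta>m\<^sup>2 + L) = M\<^sup>2 * (?V + \<eta>m\<^sup>2 * L)"
      using \<eta>m by (simp add: field_simps)
    finally have size: "(\<Sum>t=S..<T. (\<eta> t)\<^sup>2 * (norm (\<xi> t w))\<^sup>2) < M\<^sup>2 * (?V + \<eta>m\<^sup>2 * L)" .
    have "\<theta> * (\<Sum>t=S..<T. \<eta> t * (\<xi> t w \<bullet> (prox (x t w) - x t w) - drift_bound (b t) (x t w)))
        = (\<Sum>t=S..<T. Y2 t (w, \<xi> t w))"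
      unfolding sum_distrib_left Y2_def by (simp add: mult.assoc)
    also have "\<dots> < \<theta> * (4 * M * D * sqrt (L * ?V))" using 2 unfolding \<theta>L .
    finally have drift: "(\<Sum>t=S..<T. \<eta> t * (\<xi> t w \<bullet> (prox (x t w) - x t w) - drift_bound (b t) (x t w)))
        < 4 * M * D * sqrt (L * ?V)" using \<theta> by simp
    have step: "x (Suc t) w = closest_point X (x t w - \<eta> t *\<^sub>R \<xi> t w)" for t
      unfolding x_def by simp
    note avg = objective_steps_average[where x = "\<lambda>t. x t w" and v = "\<lambda>t. \<xi> t w" and \<eta> = \<eta> and b = b
        and S = S and T = T and c = c and \<epsilon> = \<epsilon>, OF x_in step less_imp_le[OF ST] _ _ c \<epsilon> size drift budget]
    show "w \<in> ?E" using w avg \<eta>(1) b(2) unfolding I_def by auto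
  qed
  \<comment> \<open>Monotonicity of the measure needs this: a nonmeasurable set would have measure 0
    by convention.\<close>
  have E_sets: "?E \<in> sets P"
  proof -
    \<comment> \<open>The samples are measurable only for \<open>t < T\<close>, so the quantities
      are continued by 0. Sums over the random set \<open>I w\<close> become sums over the fixed
      range with a case distinction.\<close>
    define G' where "G' t w = (if t < T then G (x t w) else 0)" for t w
    define r where "r t w = (if t < T then norm (prox (x t w) - x t w) else 0)" for t w
    have G'_meas[measurable]: "G' t \<in> borel_measurable P" for t
    proof (cases "t < T")
      case True
      then show ?thesis unfolding G'_def[abs_def]
        using measurable_continuous_compose[OF continuous_G x_meas_P[OF True] x_in] by simp
    qed (simp add: G'_def[abs_def])
    have r_meas[measurable]: "r t \<in> borel_measurable P" for t
    proof (cases "t < T")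
      case True
      have [measurable]: "x t \<in> borel_measurable P" "(\<lambda>w. prox (x t w)) \<in> borel_measurable P"
        using x_meas_P[OF True] measurable_continuous_compose[OF continuous_prox x_meas_P[OF True] x_in] by auto
      have "(\<lambda>w. norm (prox (x t w) - x t w)) \<in> borel_measurable P" by measurable
      then show ?thesis unfolding r_def[abs_def] using True by simp
    qed (simp add: r_def[abs_def])
    define s where "s h w = (\<Sum>t=S..<T. if G' t w \<le> b t then h t w else 0)" for h :: "nat \<Rightarrow> 's \<Rightarrow> real" and w
    have s: "(\<Sum>t\<in>I w. h t w) = s h' w" if "\<And>t. t < T \<Longrightarrow> h t w = h' t w" for h h' w
      unfolding s_def I_def sum.inter_filter[OF finite_atLeastLessThan]
      using that by (intro sum.cong) (auto simp: G'_def)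
    have s_meas[measurable]: "s h \<in> borel_measurable P" if [measurable]: "\<And>t. h t \<in> borel_measurable P" for h
      unfolding s_def[abs_def] by measurable
    have "?E = {w \<in> space P. (\<exists>t\<in>{S..<T}. G' t w \<le> b t) \<and>
        s (\<lambda>t w. \<eta> t * r t w) w \<le> \<epsilon> * s (\<lambda>t w. \<eta> t) w \<and>
        s (\<lambda>t w. \<eta> t * G' t w) w \<le> c * s (\<lambda>t w. \<eta> t) w}"
    proof (intro Collect_cong)
      fix w
      have "I w \<noteq> {} \<longleftrightarrow> (\<exists>t\<in>{S..<T}. G' t w \<le> b t)" unfolding I_def G'_def by auto
      moreover have "(\<Sum>t\<in>I w. \<eta> t * norm (prox (x t w) - x t w)) = s (\<lambda>t w. \<eta> t * r t w) w"
        by (rule s[of "\<lambda>t w. \<eta> t * norm (prox (x t w) - x t w)"]) (simp add: r_def)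
      moreover have "(\<Sum>t\<in>I w. \<eta> t * G (x t w)) = s (\<lambda>t w. \<eta> t * G' t w) w"
        by (rule s[of "\<lambda>t w. \<eta> t * G (x t w)"]) (simp add: G'_def)
      moreover have "(\<Sum>t\<in>I w. \<eta> t) = s (\<lambda>t w. \<eta> t) w"
        by (rule s[of "\<lambda>t w. \<eta> t"]) simp
      ultimately show "(w \<in> space P \<and> I w \<noteq> {} \<and>
          (\<Sum>t\<in>I w. \<eta> t * norm (prox (x t w) - x t w)) \<le> \<epsilon> * (\<Sum>t\<in>I w. \<eta> t) \<and>
          (\<Sum>t\<in>I w. \<eta> t * G (x t w)) \<le> c * (\<Sum>t\<in>I w. \<eta> t)) \<longleftrightarrow>
        (w \<in> space P \<and> (\<exists>t\<in>{S..<T}. G' t w \<le> b t) \<and>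
          s (\<lambda>t w. \<eta> t * r t w) w \<le> \<epsilon> * s (\<lambda>t w. \<eta> t) w \<and>
          s (\<lambda>t w. \<eta> t * G' t w) w \<le> c * s (\<lambda>t w. \<eta> t) w)" by (simp only:)
    qed
    also have "\<dots> \<in> sets P" by measurable
    finally show ?thesis .
  qed
  have "1 - 2 * exp (- L) \<le> 1 - (prob E1 + prob E2)" using E1 E2 by simp
  also have "\<dots> \<le> 1 - prob (E1 \<union> E2)"
    using measure_Un_le[OF E1_sets E2_sets] by simp
  also have "\<dots> = prob (space P - (E1 \<union> E2))"
    using E1_sets E2_sets by (intro prob_compl[symmetric]) auto
  also have "\<dots> \<le> prob ?E" by (intro finite_measure_mono sub E_sets)
  finally show ?thesis .
qed

section \<open>The budget for the two step-size rules\<close>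

text \<open>All terms are compared with \<open>A = T * M^2 * \<eta>^2\<close>. The step size makes
  the right side \<open>5 / 2 * A\<close>; the left side consists of three pieces of at most
  \<open>A / 2\<close> (diameter, squared steps, their deviation) and a drift deviation of at most
  \<open>A\<close>. The three bounds on \<open>T\<close> control the diameter, the size deviation
  and the drift deviation.\<close>

lemma constant_step_budget:
  fixes M D c L :: real
  assumes pos: "M > 0" "D > 0" "c > 0" "L > 0" and \<eta>: "\<eta> = 2 * c / (5 * M\<^sup>2)"
    and T: "25 * M\<^sup>2 * D\<^sup>2 / (4 * c\<^sup>2) \<le> real T" "L \<le> real T" "300 * L * M\<^sup>2 * D\<^sup>2 / c\<^sup>2 \<le> real T"
  shows "D\<^sup>2 / 2 + M\<^sup>2 * ((\<Sum>t=0..<T. \<eta>\<^sup>2) + \<eta>\<^sup>2 * L) / 2 + 4 * M * D * sqrt (L * (\<Sum>t=0..<T. \<eta>\<^sup>2))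
    \<le> (\<Sum>t=0..<T. \<eta> * c)"
proof -
  have c: "c = 5 * M\<^sup>2 * \<eta> / 2" using pos \<eta> by simp
  define A where "A = real T * (M\<^sup>2 * \<eta>\<^sup>2)"
  have \<eta>0: "\<eta> > 0" using pos \<eta> by simp
  have c2: "4 * c\<^sup>2 = 25 * M\<^sup>2 * (M\<^sup>2 * \<eta>\<^sup>2)" unfolding c by (simp add: power2_eq_square)
  have "25 * M\<^sup>2 * D\<^sup>2 \<le> real T * (4 * c\<^sup>2)" using T(1) pos by (simp add: pos_divide_le_eq)
  also have "\<dots> = 25 * M\<^sup>2 * A" unfolding c2 A_def by simp
  finally have D: "D\<^sup>2 \<le> A" using pos by simp
  have "300 * L * M\<^sup>2 * D\<^sup>2 \<le> real T * c\<^sup>2" using T(3) pos by (simp add: pos_divide_le_eq)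
  then have "4 * (300 * L * M\<^sup>2 * D\<^sup>2) \<le> 4 * (real T * c\<^sup>2)" by (rule mult_left_mono) simp
  also have "\<dots> = real T * (4 * c\<^sup>2)" by simp
  also have "\<dots> = 25 * M\<^sup>2 * A" unfolding c2 A_def by simp
  finally have "(25 * M\<^sup>2) * (48 * L * D\<^sup>2) \<le> (25 * M\<^sup>2) * A" by (simp add: mult_ac)
  then have LD: "48 * L * D\<^sup>2 \<le> A" using pos by simp
  have A0: "0 \<le> A" unfolding A_def by simp
  have LA: "M\<^sup>2 * (\<eta>\<^sup>2 * L) \<le> A"
    unfolding A_def using mult_right_mono[OF T(2), of "M\<^sup>2 * \<eta>\<^sup>2"] by (simp add: mult_ac)
  have "4 * M * D * sqrt (L * (real T * \<eta>\<^sup>2)) = sqrt ((4 * M * D)\<^sup>2 * (L * (real T * \<eta>\<^sup>2)))"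
    using pos by (simp add: real_sqrt_mult)
  also have "(4 * M * D)\<^sup>2 * (L * (real T * \<eta>\<^sup>2)) = (16 * L * D\<^sup>2) * A"
    unfolding A_def by (simp add: power2_eq_square)
  also have "sqrt \<dots> \<le> sqrt (A * A)"
    using LD A0 pos by (intro real_sqrt_le_mono mult_right_mono) auto
  also have "\<dots> = A" using A0 by simp
  finally have "4 * M * D * sqrt (L * (real T * \<eta>\<^sup>2)) \<le> A" .
  moreover have "real T * (\<eta> * c) = 5 / 2 * A" unfolding c A_def by (simp add: power2_eq_square)
  moreover have "M\<^sup>2 * (real T * \<eta>\<^sup>2 + \<eta>\<^sup>2 * L) / 2 = A / 2 + M\<^sup>2 * (\<eta>\<^sup>2 * L) / 2"
    unfolding A_def by (simp add: field_simps)
  ultimately have "D\<^sup>2 / 2 + M\<^sup>2 * (real T * \<eta>\<^sup>2 + \<eta>\<^sup>2 * L) / 2 + 4 * M * D * sqrt (L * (real T * \<eta>\<^sup>2))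
      \<le> real T * (\<eta> * c)" using D LA by linarith
  then show ?thesis by simp
qed

text \<open>Divided by the square of \<open>D\<close>, everything depends on the window
  \<open>H\<close> of the harmonic series. As \<open>H\<close> is at least 1/2, each constant on the
  left may be doubled and multiplied by \<open>H\<close>, which produces the 4, the
  \<open>2 * L\<close> and the factor 8 in the demand on \<open>E\<close>.\<close>

lemma diminishing_step_budget:
  fixes M D E L :: real and T :: nat
  defines "S \<equiv> T div 2" and "\<eta> \<equiv> \<lambda>t. D / (M * sqrt (real (t + 1)))"
  assumes pos: "M > 0" "D > 0" "L > 0" and T: "T > 0"
    and L8: "L \<le> L8" and L4: "L \<le> L4"
    and E: "4 + 2 * pi / sqrt 6 * max (sqrt (12 * L8)) (4 / 3 * L8) + 8 * sqrt (3 * L4) \<le> E"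
  shows "D\<^sup>2 / 2 + M\<^sup>2 * ((\<Sum>t=S..<T. (\<eta> t)\<^sup>2) + (D / M)\<^sup>2 * L) / 2 + 4 * M * D * sqrt (L * (\<Sum>t=S..<T. (\<eta> t)\<^sup>2))
    \<le> (\<Sum>t=S..<T. \<eta> t * (E * M * D / sqrt (real (t + 1))))"
proof -
  define H where "H = (\<Sum>t=S..<T. 1 / real (t + 1))"
  \<comment> \<open>With \<open>S\<close> rounded down, the window holds at least half of the
    indices, each contributing at least \<open>1 / T\<close>, and at most \<open>S + 1\<close> of
    them, each contributing at most \<open>1 / (S + 1)\<close>.\<close>
  have T2: "T \<le> 2 * S + 1" "2 * S \<le> T" unfolding S_def by auto
  have "(\<Sum>t=S..<T. 1 / real T) \<le> H" unfolding H_def using T by (intro sum_mono) (auto intro!: divide_left_mono)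
  then have "real (T - S) / real T \<le> H" by simp
  moreover have "1 / 2 \<le> real (T - S) / real T" using T T2 by (simp add: field_simps of_nat_diff)
  ultimately have H1: "1 / 2 \<le> H" by linarith
  have "H \<le> (\<Sum>t=S..<T. 1 / real (S + 1))" unfolding H_def by (intro sum_mono) (auto intro!: divide_left_mono)
  also have "\<dots> = real (T - S) / real (S + 1)" by simp
  also have "\<dots> \<le> 1" using T2 by simp
  finally have H2: "H \<le> 1" .
  have \<eta>2: "(\<eta> t)\<^sup>2 = (D / M)\<^sup>2 * (1 / real (t + 1))" for t
    unfolding \<eta>_def by (simp add: power_divide power_mult_distrib)
  have V: "(\<Sum>t=S..<T. (\<eta> t)\<^sup>2) = (D / M)\<^sup>2 * H" unfolding \<eta>2 H_def sum_distrib_left ..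
  have "(\<Sum>t=S..<T. \<eta> t * (E * M * D / sqrt (real (t + 1)))) = (\<Sum>t=S..<T. E * D\<^sup>2 * (1 / real (t + 1)))"
    unfolding \<eta>_def using pos by (intro sum.cong refl) (simp add: power2_eq_square field_simps)
  also have "\<dots> = D\<^sup>2 * (E * H)" unfolding H_def sum_distrib_left by (simp add: mult_ac)
  finally have rhs: "(\<Sum>t=S..<T. \<eta> t * (E * M * D / sqrt (real (t + 1)))) = D\<^sup>2 * (E * H)" .
  have "sqrt (L * ((D / M)\<^sup>2 * H)) = D / M * sqrt (L * H)"
    using pos by (simp add: real_sqrt_mult real_sqrt_divide)
  then have lhs: "D\<^sup>2 / 2 + M\<^sup>2 * ((D / M)\<^sup>2 * H + (D / M)\<^sup>2 * L) / 2 + 4 * M * D * sqrt (L * ((D / M)\<^sup>2 * H))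
      = D\<^sup>2 * (1 / 2 + (H + L) / 2 + 4 * sqrt (L * H))"
    using pos by (simp add: power2_eq_square field_simps)
  \<comment> \<open>Shows \<open>2 * pi / sqrt 6 \<ge> 2\<close>, so that this part of
    \<open>E\<close> pays for \<open>2 * L\<close>.\<close>
  have "sqrt 6 \<le> sqrt ((5 / 2)\<^sup>2)" by (intro real_sqrt_le_mono) (simp add: power2_eq_square)
  then have "sqrt 6 \<le> pi" using pi_gt3 by simp
  then have "2 \<le> 2 * pi / sqrt 6" by (simp add: pos_le_divide_eq)
  moreover have "L \<le> max (sqrt (12 * L8)) (4 / 3 * L8)" using L8 pos by auto
  ultimately have "2 * L \<le> 2 * pi / sqrt 6 * max (sqrt (12 * L8)) (4 / 3 * L8)"
    using pos by (intro mult_mono) auto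
  moreover have "sqrt (L * H) \<le> sqrt (3 * L4)"
    using L4 H1 H2 pos mult_mono[of L L4 H 1] by (intro real_sqrt_le_mono) auto
  ultimately have E': "4 + 2 * L + 8 * sqrt (L * H) \<le> E" using E by linarith
  have "1 / 2 + (H + L) / 2 + 4 * sqrt (L * H) \<le> 4 * H + (2 * L + 8 * sqrt (L * H)) * (1 / 2)"
    using H1 pos by (simp add: field_simps)
  also have "\<dots> \<le> 4 * H + (2 * L + 8 * sqrt (L * H)) * H"
    using H1 pos by (intro add_left_mono mult_left_mono) auto
  also have "\<dots> = (4 + 2 * L + 8 * sqrt (L * H)) * H" by (simp add: algebra_simps)
  also have "\<dots> \<le> E * H" using E' H1 by (intro mult_right_mono) auto
  finally show ?thesis unfolding V rhs lhs using pos by (intro mult_left_mono) auto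
qed

text \<open>In Case II an odd \<open>T\<close> is covered as well, with \<open>S\<close> rounded
  down.\<close>

theorem theoremA13:
  fixes X :: "'a::euclidean_space set"
    and f g :: "'a \<Rightarrow> ereal"
    and M D \<rho> \<rho>h \<Lambda> \<epsilon> \<delta> :: real
    and x_feas x0 :: 'a
    and Q\<^sub>\<omega> :: "'a \<Rightarrow> real measure"
    and Q\<^sub>f Q\<^sub>g :: "'a \<Rightarrow> 'a measure"
    and P :: "'s measure"
    and S T B :: nat
    and tol \<eta> :: "nat \<Rightarrow> real"
    and \<omega> :: "nat \<Rightarrow> nat \<Rightarrow> 's \<Rightarrow> real"
    and \<xi> :: "nat \<Rightarrow> 's \<Rightarrow> 'a"
  defines "x \<equiv> iterate X \<eta> x0 \<xi>"
    and "xh \<equiv> (\<lambda>t w. constrained_prox X f g \<rho>h (iterate X \<eta> x0 \<xi> t w))"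
    and "I \<equiv> objective_steps S T B tol \<omega>"
  assumes "closed X" and "convex X"
    and "proper_continuous_on X f" and "proper_continuous_on X g"
    and "\<And>y. y \<in> X \<Longrightarrow> frechet_subdiff f y \<noteq> {}"
    and "\<And>y. y \<in> X \<Longrightarrow> frechet_subdiff g y \<noteq> {}"
    and "M > 0"
    and "\<And>y \<zeta>. y \<in> X \<Longrightarrow> \<zeta> \<in> frechet_subdiff f y \<Longrightarrow> norm \<zeta> \<le> M"
    and "\<And>y \<zeta>. y \<in> X \<Longrightarrow> \<zeta> \<in> frechet_subdiff g y \<Longrightarrow> norm \<zeta> \<le> M"
    and "weakly_convex_on \<rho> X f"
    and "weakly_convex_on 0 X g"
    and "x_feas \<in> rel_interior X" and "g x_feas < 0"
    and "D > 0" and "\<And>y y'. y \<in> X \<Longrightarrow> y' \<in> X \<Longrightarrow> norm (y - y') \<le> D"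
    and "value_oracle X g Q\<^sub>\<omega>"
    and "subgradient_oracle X f M Q\<^sub>f"
    and "subgradient_oracle X g M Q\<^sub>g"
    and "\<rho>h > \<rho>"
    and "\<Lambda> = (M * D + \<rho>h * D\<^sup>2) / (- real_of_ereal (g x_feas))"
    and "\<epsilon> > 0" and "0 < \<delta>" and "\<delta> < 1"
    and "switching_run P X Q\<^sub>\<omega> Q\<^sub>f Q\<^sub>g B T tol \<eta> x0 \<omega> \<xi>"
    and "B = 1"
    and "\<And>t w. t < T \<Longrightarrow> w \<in> space P \<Longrightarrow> batch_mean B \<omega> t w = real_of_ereal (g (x t w))"
    and parameter_choice:
      "(S = 0 \<and>
        (\<forall>t<T. tol t = \<epsilon>\<^sup>2 * (\<rho>h - \<rho>) / (1 + \<Lambda>)) \<and>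
        (\<forall>t<T. \<eta> t = 2 * \<epsilon>\<^sup>2 * (\<rho>h - \<rho>) / (5 * (1 + \<Lambda>) * M\<^sup>2)) \<and>
        real T \<ge> max (25 * M\<^sup>2 * D\<^sup>2 * (1 + \<Lambda>)\<^sup>2 / (4 * \<epsilon>^4 * (\<rho>h - \<rho>)\<^sup>2))
                 (max (max (12 * ln (8 / \<delta>)) (16 / 9 * (ln (8 / \<delta>))\<^sup>2))
                      (300 * ln (4 / \<delta>) * M\<^sup>2 * D\<^sup>2 * (1 + \<Lambda>)\<^sup>2 / (\<epsilon>^4 * (\<rho>h - \<rho>)\<^sup>2))))
       \<or>
       (S = T div 2 \<and>
        (\<forall>t<T. \<eta> t = D / (M * sqrt (real (t + 1)))) \<and>
        (\<exists>E>0.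
          E \<ge> 4 + 2 * pi / sqrt 6 * max (sqrt (12 * ln (8 / \<delta>))) (4 / 3 * ln (8 / \<delta>))
                + 8 * sqrt (3 * ln (4 / \<delta>)) \<and>
          (\<forall>t<T. tol t = E * M * D / sqrt (real (t + 1))) \<and>
          real T \<ge> 2 * E\<^sup>2 * M\<^sup>2 * D\<^sup>2 * (1 + \<Lambda>)\<^sup>2 / (\<epsilon>^4 * (\<rho>h - \<rho>)\<^sup>2)))"
  shows "measure P {w \<in> space P.
           I w \<noteq> {} \<and>
           measure_pmf.expectation (output_index \<eta> (I w)) (\<lambda>t. norm (xh t w - x t w)) \<le> \<epsilon> \<and>
           measure_pmf.expectation (output_index \<eta> (I w)) (\<lambda>t. real_of_ereal (g (x t w)))
             \<le> \<epsilon>\<^sup>2 * (\<rho>h - \<rho>) / (1 + \<Lambda>)} \<ge> 1 - \<delta>"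
proof -
  interpret constrained_problem X f g M D \<rho> \<rho>h x_feas
    using assms(4-18) assms(22) rel_interior_subset[of X] by unfold_locales auto
  have \<Lambda>: "\<Lambda> = multiplier_bound" unfolding multiplier_bound_def G_def assms by simp
  have \<Lambda>0: "\<Lambda> > 0" unfolding \<Lambda> by (rule multiplier_bound_pos)
  note run = \<open>switching_run P X Q\<^sub>\<omega> Q\<^sub>f Q\<^sub>g B T tol \<eta> x0 \<omega> \<xi>\<close>[unfolded switching_run_def]
  have x0: "x0 \<in> X" and T: "0 < T" using run by auto
  have x_in: "x t w \<in> X" for t w unfolding x_def using x0 by (rule iterate_in)
  have batch: "batch_mean B \<omega> t w = G (x t w)" if "t < T" "w \<in> space P" for t w
    unfolding G_def by (rule assms(29)[OF that])
  \<comment> \<open>The history includes the batch of iteration \<open>t\<close> but not its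
    subgradient; exactness replaces the batch mean by \<open>G\<close> in the choice of
    branch.\<close>
  have samples: "adapted_oracle P T (\<lambda>t. history P B \<omega> \<xi> (Suc t) t) \<xi>
      (\<lambda>t w. if G (x t w) \<le> tol t then Q\<^sub>f (x t w) else Q\<^sub>g (x t w))"
  proof (intro adapted_oracle.intro adapted_oracle_axioms.intro)
    show "prob_space P" using run by auto
    fix t assume t: "t < T"
    show "subalgebra P (history P B \<omega> \<xi> (Suc t) t)"
      using run t by (intro subalgebra_history(1)) auto
    show "\<xi> t \<in> borel_measurable P" using run t by auto
    show "\<xi> s \<in> borel_measurable (history P B \<omega> \<xi> (Suc t) t)" if "s < t" for s
      using run t that by (intro subalgebra_history(2)) auto
    fix w assume "w \<in> space P"
    show "prob_space (if G (x t w) \<le> tol t then Q\<^sub>f (x t w) else Q\<^sub>g (x t w))"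
      "sets (if G (x t w) \<le> tol t then Q\<^sub>f (x t w) else Q\<^sub>g (x t w)) = sets borel"
      using \<open>subgradient_oracle X f M Q\<^sub>f\<close> \<open>subgradient_oracle X g M Q\<^sub>g\<close> x_in
      unfolding subgradient_oracle_def by auto
  next
    fix t A assume t: "t < T" and A: "A \<in> sets (borel :: 'a measure)"
    have "AE w in P. real_cond_exp P (history P B \<omega> \<xi> (Suc t) t) (indicator {w \<in> space P. \<xi> t w \<in> A}) w
        = (if batch_mean B \<omega> t w \<le> tol t then measure (Q\<^sub>f (x t w)) A else measure (Q\<^sub>g (x t w)) A)"
      using run t A unfolding x_def by blast
    then show "AE w in P. real_cond_exp P (history P B \<omega> \<xi> (Suc t) t) (indicator {w \<in> space P. \<xi> t w \<in> A}) w
        = measure (if G (x t w) \<le> tol t then Q\<^sub>f (x t w) else Q\<^sub>g (x t w)) A"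
      using AE_space
    proof eventually_elim
      case (elim w)
      show ?case unfolding elim(1) batch[OF t elim(2)] by simp
    qed
  qed
  define c where "c = \<epsilon>\<^sup>2 * (\<rho>h - \<rho>) / (1 + \<Lambda>)"
  have c: "(1 + multiplier_bound) * c = \<epsilon>\<^sup>2 * (\<rho>h - \<rho>)" and c0: "c > 0"
    unfolding c_def \<Lambda>[symmetric] using \<Lambda>0 \<rho>h_gt \<open>\<epsilon> > 0\<close> by auto
  \<comment> \<open>In the bounds on \<open>T\<close>, the quantities \<open>\<Lambda>\<close>,
    \<open>\<epsilon>\<close> and \<open>\<rho>h - \<rho>\<close> occur only through
    \<open>c\<close>.\<close>
  have c2: "q * (1 + \<Lambda>)\<^sup>2 / (r * \<epsilon>^4 * (\<rho>h - \<rho>)\<^sup>2) = q / (r * c\<^sup>2)" for q r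
  proof -
    have "c\<^sup>2 * (1 + \<Lambda>)\<^sup>2 = \<epsilon>^4 * (\<rho>h - \<rho>)\<^sup>2"
      using c unfolding \<Lambda>[symmetric] by (metis mult.commute power_mult_distrib power_mult numeral_Bit0 mult_2)
    then have eq: "r * \<epsilon>^4 * (\<rho>h - \<rho>)\<^sup>2 = r * c\<^sup>2 * (1 + \<Lambda>)\<^sup>2" by (simp add: mult.assoc)
    have "(1 + \<Lambda>)\<^sup>2 \<noteq> 0" using \<Lambda>0 by simp
    then show ?thesis unfolding eq by (rule mult_divide_mult_cancel_right)
  qed
  \<comment> \<open>Each of the two exceptional events receives probability
    \<open>\<delta> / 2\<close>.\<close>
  define L where "L = ln (2 / \<delta>)"
  have L: "L > 0" "L \<le> ln (4 / \<delta>)" "L \<le> ln (8 / \<delta>)"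
    unfolding L_def using \<open>0 < \<delta>\<close> \<open>\<delta> < 1\<close> by (auto simp: field_simps)
  \<comment> \<open>The two cases meet here; the witness is the constant step in Case I and
    \<open>D / M\<close>, the bound at index 0, in Case II.\<close>
  have "\<exists>\<eta>m. S < T \<and> (\<forall>t<T. 0 < \<eta> t \<and> 0 \<le> tol t) \<and> (\<forall>t. S \<le> t \<longrightarrow> t < T \<longrightarrow> \<eta> t \<le> \<eta>m \<and> tol t \<le> c) \<and>
      D\<^sup>2 / 2 + M\<^sup>2 * ((\<Sum>t=S..<T. (\<eta> t)\<^sup>2) + \<eta>m\<^sup>2 * L) / 2
        + 4 * M * D * sqrt (L * (\<Sum>t=S..<T. (\<eta> t)\<^sup>2)) \<le> (\<Sum>t=S..<T. \<eta> t * tol t)"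
    using parameter_choice
  proof (elim disjE conjE exE)
    assume S: "S = 0" and tol: "\<forall>t<T. tol t = \<epsilon>\<^sup>2 * (\<rho>h - \<rho>) / (1 + \<Lambda>)"
      and \<eta>: "\<forall>t<T. \<eta> t = 2 * \<epsilon>\<^sup>2 * (\<rho>h - \<rho>) / (5 * (1 + \<Lambda>) * M\<^sup>2)"
      and Tb: "real T \<ge> max (25 * M\<^sup>2 * D\<^sup>2 * (1 + \<Lambda>)\<^sup>2 / (4 * \<epsilon>^4 * (\<rho>h - \<rho>)\<^sup>2))
                 (max (max (12 * ln (8 / \<delta>)) (16 / 9 * (ln (8 / \<delta>))\<^sup>2))
                      (300 * ln (4 / \<delta>) * M\<^sup>2 * D\<^sup>2 * (1 + \<Lambda>)\<^sup>2 / (\<epsilon>^4 * (\<rho>h - \<rho>)\<^sup>2)))"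
    define e where "e = 2 * c / (5 * M\<^sup>2)"
    have tol': "tol t = c" and \<eta>': "\<eta> t = e" if "t < T" for t
      using tol \<eta> that unfolding e_def c_def by (auto simp: mult_ac)
    have "25 * M\<^sup>2 * D\<^sup>2 / (4 * c\<^sup>2) \<le> real T" using Tb c2[of "25 * M\<^sup>2 * D\<^sup>2" 4] by simp
    moreover have "L \<le> real T" using Tb L by simp
    moreover have "300 * L * M\<^sup>2 * D\<^sup>2 / c\<^sup>2 \<le> real T"
    proof -
      have "300 * L * M\<^sup>2 * D\<^sup>2 / c\<^sup>2 \<le> 300 * ln (4 / \<delta>) * M\<^sup>2 * D\<^sup>2 / c\<^sup>2"
        using L by (intro divide_right_mono mult_right_mono) auto
      then show ?thesis using Tb c2[of "300 * ln (4 / \<delta>) * M\<^sup>2 * D\<^sup>2" 1] by simp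
    qed
    ultimately have "D\<^sup>2 / 2 + M\<^sup>2 * ((\<Sum>t=0..<T. e\<^sup>2) + e\<^sup>2 * L) / 2
        + 4 * M * D * sqrt (L * (\<Sum>t=0..<T. e\<^sup>2)) \<le> (\<Sum>t=0..<T. e * c)"
      using M_pos D_pos c0 L(1) e_def by (intro constant_step_budget)
    moreover have "e > 0" unfolding e_def using c0 M_pos by simp
    ultimately show ?thesis using S T c0 \<eta>' tol' by (intro exI[of _ e]) simp
  next
    fix E assume S: "S = T div 2" and \<eta>: "\<forall>t<T. \<eta> t = D / (M * sqrt (real (t + 1)))"
      and E0: "0 < E"
      and E: "4 + 2 * pi / sqrt 6 * max (sqrt (12 * ln (8 / \<delta>))) (4 / 3 * ln (8 / \<delta>))
                + 8 * sqrt (3 * ln (4 / \<delta>)) \<le> E"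
      and tol: "\<forall>t<T. tol t = E * M * D / sqrt (real (t + 1))"
      and Tb: "real T \<ge> 2 * E\<^sup>2 * M\<^sup>2 * D\<^sup>2 * (1 + \<Lambda>)\<^sup>2 / (\<epsilon>^4 * (\<rho>h - \<rho>)\<^sup>2)"
    have "2 * E\<^sup>2 * M\<^sup>2 * D\<^sup>2 / c\<^sup>2 \<le> real T"
      using Tb c2[of "2 * E\<^sup>2 * M\<^sup>2 * D\<^sup>2" 1] by simp
    then have Tc: "2 * (E * M * D)\<^sup>2 \<le> c\<^sup>2 * real T"
      using c0 by (simp add: pos_divide_le_eq power_mult_distrib mult_ac)
    have bound: "\<eta> t \<le> D / M \<and> tol t \<le> c" if t: "S \<le> t" "t < T" for t
    proof
      have "1 \<le> sqrt (real (t + 1))" by simp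
      then have "M * 1 \<le> M * sqrt (real (t + 1))" using M_pos by (intro mult_left_mono) auto
      then show "\<eta> t \<le> D / M" using \<eta> t M_pos D_pos by (auto intro!: divide_left_mono)
      \<comment> \<open>From \<open>T div 2\<close> on, \<open>t + 1\<close> is at least half of
        \<open>T\<close>, so the lower bound on \<open>T\<close> pushes the decreasing tolerance
        below \<open>c\<close>.\<close>
      have "T \<le> 2 * (t + 1)" using t S by presburger
      then have "real T \<le> 2 * real (t + 1)" by linarith
      then have "c\<^sup>2 * real T \<le> c\<^sup>2 * (2 * real (t + 1))" by (intro mult_left_mono) auto
      then have "(E * M * D)\<^sup>2 \<le> c\<^sup>2 * real (t + 1)" using Tc by linarith
      then have "(E * M * D)\<^sup>2 \<le> (c * sqrt (real (t + 1)))\<^sup>2" by (simp add: power_mult_distrib)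
      then have "E * M * D \<le> c * sqrt (real (t + 1))" by (rule power2_le_imp_le) (use c0 in simp)
      then show "tol t \<le> c" using tol t by (simp add: pos_divide_le_eq)
    qed
    have "(\<Sum>t=S..<T. (\<eta> t)\<^sup>2) = (\<Sum>t=S..<T. (D / (M * sqrt (real (t + 1))))\<^sup>2)"
      "(\<Sum>t=S..<T. \<eta> t * tol t) = (\<Sum>t=S..<T. D / (M * sqrt (real (t + 1))) * (E * M * D / sqrt (real (t + 1))))"
      using \<eta> tol by (auto intro!: sum.cong)
    then have "D\<^sup>2 / 2 + M\<^sup>2 * ((\<Sum>t=S..<T. (\<eta> t)\<^sup>2) + (D / M)\<^sup>2 * L) / 2
        + 4 * M * D * sqrt (L * (\<Sum>t=S..<T. (\<eta> t)\<^sup>2)) \<le> (\<Sum>t=S..<T. \<eta> t * tol t)"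
      using diminishing_step_budget[OF M_pos D_pos L(1) T L(3) L(2) E] unfolding S by (simp only:)
    moreover have "S < T" using S T by simp
    moreover have "\<forall>t<T. 0 < \<eta> t \<and> 0 \<le> tol t" using \<eta> tol M_pos D_pos E0 by simp
    ultimately show ?thesis using bound by (intro exI[of _ "D / M"]) simp
  qed
  then obtain \<eta>m where ST: "S < T" and \<eta>: "\<And>t. t < T \<Longrightarrow> 0 < \<eta> t" "\<And>t. S \<le> t \<Longrightarrow> t < T \<Longrightarrow> \<eta> t \<le> \<eta>m"
    and tol: "\<And>t. t < T \<Longrightarrow> 0 \<le> tol t" "\<And>t. S \<le> t \<Longrightarrow> t < T \<Longrightarrow> tol t \<le> c"
    and budget: "D\<^sup>2 / 2 + M\<^sup>2 * ((\<Sum>t=S..<T. (\<eta> t)\<^sup>2) + \<eta>m\<^sup>2 * L) / 2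
        + 4 * M * D * sqrt (L * (\<Sum>t=S..<T. (\<eta> t)\<^sup>2)) \<le> (\<Sum>t=S..<T. \<eta> t * tol t)" by auto
  define J where "J w = {t \<in> {S..<T}. G (x t w) \<le> tol t}" for w
  \<comment> \<open>The two index sets agree only on the sample space, where the batch values are
    exact.\<close>
  have J: "J w = I w" if "w \<in> space P" for w
    unfolding J_def I_def objective_steps_def using batch[OF _ that] by auto
  have "exp (- L) = \<delta> / 2" unfolding L_def using \<open>0 < \<delta>\<close> by (simp add: exp_minus)
  then have "1 - \<delta> = 1 - 2 * exp (- L)" by simp
  also have "\<dots> \<le> measure P {w \<in> space P. J w \<noteq> {} \<and>
      (\<Sum>t\<in>J w. \<eta> t * norm (prox (x t w) - x t w)) \<le> \<epsilon> * (\<Sum>t\<in>J w. \<eta> t) \<and>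
      (\<Sum>t\<in>J w. \<eta> t * G (x t w)) \<le> c * (\<Sum>t\<in>J w. \<eta> t)}"
    unfolding J_def x_def
    by (rule switching_method_probability[OF samples[unfolded x_def] x0 \<open>subgradient_oracle X f M Q\<^sub>f\<close>
          \<open>subgradient_oracle X g M Q\<^sub>g\<close> ST \<eta> tol c \<open>\<epsilon> > 0\<close> L(1) budget])
  also have "{w \<in> space P. J w \<noteq> {} \<and>
      (\<Sum>t\<in>J w. \<eta> t * norm (prox (x t w) - x t w)) \<le> \<epsilon> * (\<Sum>t\<in>J w. \<eta> t) \<and>
      (\<Sum>t\<in>J w. \<eta> t * G (x t w)) \<le> c * (\<Sum>t\<in>J w. \<eta> t)} =
    {w \<in> space P. I w \<noteq> {} \<and>
           measure_pmf.expectation (output_index \<eta> (I w)) (\<lambda>t. norm (xh t w - x t w)) \<le> \<epsilon> \<and>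
           measure_pmf.expectation (output_index \<eta> (I w)) (\<lambda>t. real_of_ereal (g (x t w))) \<le> c}"
  proof -
    have "(J w \<noteq> {} \<and> (\<Sum>t\<in>J w. \<eta> t * norm (prox (x t w) - x t w)) \<le> \<epsilon> * (\<Sum>t\<in>J w. \<eta> t) \<and>
        (\<Sum>t\<in>J w. \<eta> t * G (x t w)) \<le> c * (\<Sum>t\<in>J w. \<eta> t)) \<longleftrightarrow>
      (I w \<noteq> {} \<and> measure_pmf.expectation (output_index \<eta> (I w)) (\<lambda>t. norm (xh t w - x t w)) \<le> \<epsilon> \<and>
        measure_pmf.expectation (output_index \<eta> (I w)) (\<lambda>t. real_of_ereal (g (x t w))) \<le> c)"
      if w: "w \<in> space P" for w
    \<comment> \<open>For empty \<open>I w\<close> both sides are false, so the law of the output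
      index is consulted only where it is specified.\<close>
    proof (cases "I w = {}")
      case False
      have I: "finite (I w)" "\<And>t. t \<in> I w \<Longrightarrow> 0 < \<eta> t"
        unfolding I_def objective_steps_def using \<eta>(1) by auto
      have E: "measure_pmf.expectation (output_index \<eta> (I w)) h = (\<Sum>t\<in>I w. \<eta> t * h t) / (\<Sum>t\<in>I w. \<eta> t)"
        for h :: "nat \<Rightarrow> real"
        using I False by (intro expectation_output_index)
      have "0 < (\<Sum>t\<in>I w. \<eta> t)" using I False by (intro sum_pos) auto
      then show ?thesis
        unfolding J[OF w] E
        by (simp add: pos_divide_le_eq xh_def x_def prox_def G_def)
    qed (simp add: J[OF w])
    then show ?thesis by blast
  qed
  finally show ?thesis unfolding c_def .
qed

end
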